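(* Let $r\in\{1,\ldots,d\wedge n\}$, let $\varepsilon_1,\varepsilon_2\in(0,1)$, and let $R$ be a random $d\times k$ matrix whose entries are drawn i.i.d. from a zero-mean sub-Gaussian distribution with variance $1/k$. If $$k \;=\; \Omega\Big(\varepsilon_1^{-2}\, r\,\{\log(r)+\log(n)\}\ \vee\ \varepsilon_2^{-2}\log(\varepsilon_2^{-1})\, r\Big),$$ then $R$ satisfies both of the following conditions, with $\delta_1=\exp(-c'\log(n\,r))$ and $\delta_2=\exp(-c\log(\varepsilon_2^{-1})\,r)$ for absolute constants $c,c'>0$: (C1) $R$ is a $(2nr,\varepsilon_1/\sqrt r,\delta_1)$-Johnson-Lindenstrauss transform: for an arbitrary fixed set of $2nr$ points $v_1,\ldots,v_{2nr}\in\mathbb{R}^d$, with probability at least $1-\delta_1$, $$\left(1-\tfrac{\varepsilon_1}{\sqrt r}\right)\|v_i\|_2^2 \le \|R^\top v_i\|_2^2\le \left(1+\tfrac{\varepsilon_1}{\sqrt r}\right)\|v_i\|_2^2\quad\text{for all } i=1,\ldots,2nr;$$ (C2) $R$ is an $(r,\varepsilon_2,\delta_2)$-restricted isometry: for an arbitrary fixed subspace $\mathcal{V}\subset\mathbb{R}^d$ of dimension $r$, with probability at least $1-\delta_2$, $$(1-\varepsilon_2)\|v\|_2\le\|R^\top v\|_2\le(1+\varepsilon_2)\|v\|_2\quad\text{for all } v\in\mathcal{V}.$$ Moreover, if $r=O(1)$, the factor $r$ can be replaced by $r\vee\log n$ in the second term $\varepsilon_2^{-2}\log(\varepsilon_2^{-1})\,r$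 of the condition on $k$ and in $\delta_2$, so that the failure probability becomes small as $n$ grows.
   Context: $n,d,k$ are positive integers, $a\wedge b=\min\{a,b\}$, $a\vee b=\max\{a,b\}$. $O$ and $\Omega$ are the usual Big-O notation; $k=\Omega(g)$ means that $k$ is at least a (sufficiently large) positive constant times $g$.
   Formalization: For n = 1 only, k is additionally required to be at least the Ω-constant: as stated the claim fails there, since log(nr) = 0 and log(1/ε₂) → 0 as ε₂ → 1 allow k = 1, where entries ±3 (mass 1/18 each) and 0 (mass 8/9) violate (C2) surely. *)

theory Defs
  imports "HOL-Probability.Probability" "Jordan_Normal_Form.VS_Connect"
begin

text \<open>
  The dimensions \<open>d\<close> and \<open>k\<close> must be quantified after the absolute constants, so vectors and
  matrices have the carriers \<open>carrier_vec d\<close> and \<open>carrier_mat d k\<close> rather than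
  types indexed by their dimensions.
\<close>

definition l2norm :: "real Matrix.vec \<Rightarrow> real" where
  "l2norm v = sqrt (Matrix.scalar_prod v v)"

text \<open>
  Moment generating function form of sub-Gaussianity: \<open>\<sigma>\<^sup>2\<close> is a variance proxy of the
  distribution \<open>D\<close>.
\<close>

definition sub_gaussian :: "real \<Rightarrow> real measure \<Rightarrow> bool" where
  "sub_gaussian \<sigma> D \<longleftrightarrow>
     (\<forall>t. integrable D (\<lambda>x. exp (t * x)) \<and>
          (\<integral>x. exp (t * (x - (\<integral>y. y \<partial>D))) \<partial>D) \<le> exp (\<sigma>\<^sup>2 * t\<^sup>2 / 2))"

text \<open>
  The entry distributions for \<open>k\<close> columns.  The bound \<open>K\<close> is on the variance proxy of the
  entries multiplied by \<open>sqrt k\<close>, that is, after normalization to variance one; this is what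
  makes constants depending on \<open>K\<close> only meaningful while \<open>k\<close> varies.
\<close>

definition entry_distribution :: "real \<Rightarrow> nat \<Rightarrow> real measure \<Rightarrow> bool" where
  "entry_distribution K k D \<longleftrightarrow>
     prob_space D \<and> sets D = sets borel \<and>
     (\<integral>x. x \<partial>D) = 0 \<and>
     prob_space.variance D (\<lambda>x. x) = 1 / real k \<and>
     sub_gaussian (K / sqrt (real k)) D"

text \<open>
  The joint law of i.i.d. entries.  On this space the random matrix is \<open>Matrix.mat d k\<close>, which
  sends a family of entries \<open>\<omega>\<close> to the matrix with entry \<open>\<omega> (i, j)\<close> at \<open>(i, j)\<close>.
\<close>

definition iid_entries :: "nat \<Rightarrow> nat \<Rightarrow> real measure \<Rightarrow> (nat \<times> nat \<Rightarrow> real) measure" where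
  "iid_entries d k D = PiM ({..<d} \<times> {..<k}) (\<lambda>_. D)"

definition JL_transform ::
  "'a measure \<Rightarrow> ('a \<Rightarrow> real Matrix.mat) \<Rightarrow> nat \<Rightarrow> nat \<Rightarrow> real \<Rightarrow> real \<Rightarrow> bool" where
  "JL_transform M R d m \<epsilon> \<delta> \<longleftrightarrow>
     (\<forall>v :: nat \<Rightarrow> real Matrix.vec. (\<forall>i\<in>{1..m}. v i \<in> carrier_vec d) \<longrightarrow>
        \<P>(\<omega> in M. \<forall>i\<in>{1..m}.
              (1 - \<epsilon>) * (l2norm (v i))\<^sup>2 \<le> (l2norm (transpose_mat (R \<omega>) *\<^sub>v v i))\<^sup>2 \<and>
              (l2norm (transpose_mat (R \<omega>) *\<^sub>v v i))\<^sup>2 \<le> (1 + \<epsilon>) * (l2norm (v i))\<^sup>2)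
          \<ge> 1 - \<delta>)"

definition linear_subspace :: "nat \<Rightarrow> nat \<Rightarrow> real Matrix.vec set \<Rightarrow> bool" where
  "linear_subspace d r V \<longleftrightarrow>
     VectorSpace.subspace class_ring V (module_vec TYPE(real) d) \<and>
     vectorspace.dim class_ring (module_vec TYPE(real) d \<lparr>carrier := V\<rparr>) = r"

definition restricted_isometry ::
  "'a measure \<Rightarrow> ('a \<Rightarrow> real Matrix.mat) \<Rightarrow> nat \<Rightarrow> nat \<Rightarrow> real \<Rightarrow> real \<Rightarrow> bool" where
  "restricted_isometry M R d r \<epsilon> \<delta> \<longleftrightarrow>
     (\<forall>V. linear_subspace d r V \<longrightarrow>
        \<P>(\<omega> in M. \<forall>v\<in>V.
              (1 - \<epsilon>) * l2norm v \<le> l2norm (transpose_mat (R \<omega>) *\<^sub>v v) \<and>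
              l2norm (transpose_mat (R \<omega>) *\<^sub>v v) \<le> (1 + \<epsilon>) * l2norm v)
          \<ge> 1 - \<delta>)"

text \<open>
  \<open>k = \<Omega>(g)\<close> with implied constant \<open>C\<close>; \<open>s\<close> is the dimension factor in the second term
  of \<open>g\<close>.
\<close>

definition sample_bound :: "real \<Rightarrow> nat \<Rightarrow> nat \<Rightarrow> nat \<Rightarrow> real \<Rightarrow> real \<Rightarrow> real \<Rightarrow> bool" where
  "sample_bound C k n r \<epsilon>1 \<epsilon>2 s \<longleftrightarrow>
     real k \<ge> C * max ((1 / \<epsilon>1\<^sup>2) * real r * (ln (real r) + ln (real n)))
                      ((1 / \<epsilon>2\<^sup>2) * ln (1 / \<epsilon>2) * s)"

text \<open>
  For \<open>n \<ge> 2\<close> this bound forces \<open>k\<close> to be at least a constant multiple of \<open>C\<close>.  For \<open>n = 1\<close>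
  the first term vanishes and the second tends to zero as \<open>\<epsilon>2\<close> tends to one, so \<open>k\<close>
  sufficiently large, \<open>C \<le> k\<close>, has to be asked for separately: otherwise \<open>k = 1\<close> is allowed, and the entry
  distribution with mass 1/18 at each of \<open>3\<close> and \<open>-3\<close> and mass 8/9 at \<open>0\<close> violates the
  restricted isometry condition with probability one for \<open>d = r = 1\<close>.
\<close>

end

(*
  A unit vector v is mapped to a vector whose k coordinates are i.i.d. sub-Gaussian, so after
  scaling by sqrt k their squares minus one have a moment generating function of at most
  exp (C l^2) near 0, and Chernoff's bound gives | |R^T v|^2 - |v|^2 | <= eps |v|^2 with
  probability at least 1 - 2 exp (- eps^2 k / (4 C)).  A union bound over the points gives (C1).

  For (C2), an orthonormal basis turns |R^T v|^2 - |v|^2 into a random quadratic form on R^r.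
  A quadratic form is controlled on the unit sphere by its values on a 1/8-net of the unit ball,
  and a rescaled integer lattice provides a net with at most 2 ^ (66 r) points.

  When eps2 is close to 1 the term eps2^-2 log (1 / eps2) of the sample bound is small; the net
  cardinality is then absorbed by the first term, which is at least ln 2 times r (and ln n) if n >= 2.
*)

theory Submission
  imports Defs "Jordan_Normal_Form.Gram_Schmidt" "HOL-Real_Asymp.Real_Asymp"
begin

unbundle no vec_syntax
unbundle no inner_syntax

subsection \<open>Concentration of sums of sub-Gaussian squares\<close>

text \<open>Sub-Gaussianity controls the moment generating function of an entry, but lengths are
  sums of squares. The bridge is the power series of exp (s Z^2): each even moment is bounded
  through the moment generating function at t and -t, with t adapted to the order of the moment. The
  series converges for s = \<open>mgf_radius K\<close>, and every later constant stems from this s.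
  The passage from the net to the sphere uses no maximizer of the quadratic form. Any a priori bound
  M improves to \<eta> + M / 2, and iterating this from a crude bound by the entries gives 2 \<eta>
  in the limit. The event in (C2) quantifies over uncountably many vectors. It is measurable because
  its condition is closed in the coefficients, so a countable dense set of coefficients suffices. A
  fixed multiple of the exponent can always be bought by enlarging the constant in the sample bound;
  hence both absolute constants c and c' can be one.\<close>

lemma power_even_le_exp_sum:
  fixes x :: real
  shows "x ^ (2 * m) / fact (2 * m) \<le> exp x + exp (- x)"
proof -
  have *: "y ^ (2 * m) / fact (2 * m) \<le> exp y" if "0 \<le> y" for y :: real
  proof -
    have "(\<Sum>i\<in>{2 * m}. y ^ i /\<^sub>R fact i) \<le> exp y"
      unfolding exp_def using summable_exp_generic[of y] that by (intro sum_le_suminf) auto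
    then show ?thesis by (simp add: divide_inverse mult.commute)
  qed
  show ?thesis
  proof (cases "0 \<le> x")
    case True
    then show ?thesis using *[of x] exp_ge_zero[of "- x"] by linarith
  next
    case False
    then show ?thesis using *[of "- x"] exp_ge_zero[of x] by (simp add: power_mult add_increasing)
  qed
qed

lemma exp_le_quadratic:
  fixes x :: real
  shows "exp x \<le> 1 + x + x\<^sup>2 / 2 * exp \<bar>x\<bar>"
proof -
  obtain t where t: "\<bar>t\<bar> \<le> \<bar>x\<bar>" and e: "exp x = (\<Sum>i<2. x ^ i / fact i) + exp t / fact 2 * x ^ 2"
    using Maclaurin_exp_le[of x 2] by auto
  have "exp t \<le> exp \<bar>x\<bar>" using t by simp
  then have "exp t * (x\<^sup>2 / 2) \<le> exp \<bar>x\<bar> * (x\<^sup>2 / 2)" by (intro mult_right_mono) auto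
  then show ?thesis using e by (simp add: numeral_2_eq_2 power2_eq_square algebra_simps)
qed

text \<open>The quotient of the two factorials has m factors, each at most 2 m. The power on the
  right is the one that cancels against \<open>t ^ (2 * m)\<close> in the moment estimate.\<close>

lemma fact_double_le: "fact (2 * m) \<le> fact m * (2 * real m) ^ m"
proof -
  have "fact (2 * m) div fact (2 * m - m) \<le> (2 * m) ^ m"
    by (rule fact_div_fact_le_pow) simp
  moreover have "fact (2 * m) = fact m * (fact (2 * m) div fact m :: nat)"
    by (simp add: fact_dvd)
  ultimately have "(fact (2 * m) :: nat) \<le> fact m * (2 * m) ^ m"
    by (metis add_diff_cancel_right' mult_2 mult_le_mono2)
  then have "real (fact (2 * m)) \<le> real (fact m * (2 * m) ^ m)" by (rule of_nat_mono)
  then show ?thesis by simp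
qed

text \<open>Chosen such that s K^2 e = 1 / 2, which makes the series for the expectation of exp (s
  Z^2) geometric with ratio 1 / 2.\<close>

definition mgf_radius :: "real \<Rightarrow> real" where
  "mgf_radius K = 1 / (2 * exp 1 * K\<^sup>2)"

text \<open>The coefficient of l^2 in the exponent for Z^2 - 1. One factor 4 of the 16 comes from
  trading a square for an exponential, the other from the bound 4 on the expectation of exp (s
  Z^2).\<close>

definition mgf_const :: "real \<Rightarrow> real" where
  "mgf_const K = 16 * exp (mgf_radius K) / (mgf_radius K)\<^sup>2"

lemma mgf_const_pos: "0 < K \<Longrightarrow> 0 < mgf_const K"
  by (simp add: mgf_const_def mgf_radius_def)

text \<open>Guarantees that the optimal Chernoff parameter \<epsilon> / (2 C) with \<epsilon> < 1
  stays in the range where the moment generating function is controlled.\<close>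

lemma inverse_mgf_const_le:
  assumes "0 < K"
  shows "1 / mgf_const K \<le> mgf_radius K"
proof -
  have r: "0 < mgf_radius K" using assms by (simp add: mgf_radius_def)
  have "1 + mgf_radius K \<le> exp (mgf_radius K)" by (rule exp_ge_add_one_self)
  then have "mgf_radius K \<le> 16 * exp (mgf_radius K)" using r by linarith
  then show ?thesis using r by (simp add: mgf_const_def field_simps power2_eq_square)
qed

context prob_space
begin

definition unit_sub_gaussian_rv :: "real \<Rightarrow> ('a \<Rightarrow> real) \<Rightarrow> bool" where
  "unit_sub_gaussian_rv K Z \<longleftrightarrow> random_variable borel Z \<and>
     (\<forall>t. integrable M (\<lambda>\<omega>. exp (t * Z \<omega>)) \<and> expectation (\<lambda>\<omega>. exp (t * Z \<omega>)) \<le> exp (K\<^sup>2 * t\<^sup>2 / 2)) \<and>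
     expectation (\<lambda>\<omega>. (Z \<omega>)\<^sup>2) = 1"

text \<open>A nonnegative integral is used because integrability of this exponential is not yet
  known; it also allows the series to be integrated term by term. The terms are at most 2 (1 / 2)^m,
  with sum 4.\<close>

lemma nn_integral_exp_square_le:
  assumes K: "0 < K" and [measurable]: "random_variable borel Z"
    and int: "\<And>t. integrable M (\<lambda>\<omega>. exp (t * Z \<omega>))"
    and mgf: "\<And>t. expectation (\<lambda>\<omega>. exp (t * Z \<omega>)) \<le> exp (K\<^sup>2 * t\<^sup>2 / 2)"
  shows "(\<integral>\<^sup>+\<omega>. ennreal (exp ((Z \<omega>)\<^sup>2 / (2 * exp 1 * K\<^sup>2))) \<partial>M) \<le> 4"
proof -
  define s where "s = 1 / (2 * exp 1 * K\<^sup>2)"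
  have s: "0 < s" using K by (simp add: s_def)
  have term_le: "(\<integral>\<^sup>+\<omega>. ennreal ((s * (Z \<omega>)\<^sup>2) ^ m / fact m) \<partial>M) \<le> ennreal (2 * (1 / 2) ^ m)" for m
  proof (cases "m = 0")
    case True
    then show ?thesis by (simp add: emeasure_space_1)
  next
    case False
    \<comment> \<open>This t minimizes \<open>exp (K\<^sup>2 * t\<^sup>2 / 2) / t ^ (2 * m)\<close>
      and turns the exponential into exp m. For m = 0 it would vanish, hence the separate
      case.\<close>
    define t where "t = sqrt (2 * real m) / K"
    have t: "0 < t" using False K by (simp add: t_def)
    have t2: "t\<^sup>2 = 2 * real m / K\<^sup>2" using K by (simp add: t_def power_divide)
    have tm: "t ^ (2 * m) = (2 * real m) ^ m / (K\<^sup>2) ^ m"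
      by (simp only: power_mult t2 power_divide)
    define c where "c = s ^ m / fact m * (fact (2 * m) / t ^ (2 * m))"
    have c: "0 \<le> c" using s t by (simp add: c_def)
    have pw: "(s * (Z \<omega>)\<^sup>2) ^ m / fact m \<le> c * (exp (t * Z \<omega>) + exp ((- t) * Z \<omega>))" for \<omega>
    proof -
      have "(s * (Z \<omega>)\<^sup>2) ^ m / fact m = c * ((t * Z \<omega>) ^ (2 * m) / fact (2 * m))"
        using t by (simp add: c_def power_mult_distrib power_mult[symmetric])
      also have "\<dots> \<le> c * (exp (t * Z \<omega>) + exp (- (t * Z \<omega>)))"
        using c power_even_le_exp_sum by (intro mult_left_mono)
      finally show ?thesis by simp
    qed
    have I: "integrable M (\<lambda>\<omega>. c * (exp (t * Z \<omega>) + exp ((- t) * Z \<omega>)))"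
      by (intro integrable_mult_right Bochner_Integration.integrable_add int)
    have "(\<integral>\<^sup>+\<omega>. ennreal ((s * (Z \<omega>)\<^sup>2) ^ m / fact m) \<partial>M)
        \<le> (\<integral>\<^sup>+\<omega>. ennreal (c * (exp (t * Z \<omega>) + exp ((- t) * Z \<omega>))) \<partial>M)"
      by (intro nn_integral_mono ennreal_leI pw)
    also have "\<dots> = ennreal (\<integral>\<omega>. c * (exp (t * Z \<omega>) + exp ((- t) * Z \<omega>)) \<partial>M)"
      using I c by (intro nn_integral_eq_integral) (auto intro!: mult_nonneg_nonneg add_nonneg_nonneg)
    also have "(\<integral>\<omega>. c * (exp (t * Z \<omega>) + exp ((- t) * Z \<omega>)) \<partial>M)
        = c * (expectation (\<lambda>\<omega>. exp (t * Z \<omega>)) + expectation (\<lambda>\<omega>. exp ((- t) * Z \<omega>)))"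
      using int[of t] int[of "- t"] by simp
    also have "\<dots> \<le> c * (2 * exp (K\<^sup>2 * t\<^sup>2 / 2))"
      using mgf[of t] mgf[of "- t"] c by (intro mult_left_mono) auto
    also have "K\<^sup>2 * t\<^sup>2 / 2 = real m" using K by (simp add: t2)
    also have "c * (2 * exp (real m)) \<le> 2 * (1 / 2) ^ m"
    proof -
      have "c \<le> s ^ m / fact m * (fact m * (2 * real m) ^ m / t ^ (2 * m))"
        unfolding c_def using s t fact_double_le[of m]
        by (intro mult_left_mono divide_right_mono) auto
      also have "\<dots> = (s * K\<^sup>2) ^ m"
        using K False by (simp add: tm power_mult_distrib[of s "K\<^sup>2"])
      also have "s * K\<^sup>2 = 1 / 2 / exp 1" using K by (simp add: s_def)
      finally have "c * (2 * exp (real m)) \<le> (1 / 2 / exp 1) ^ m * (2 * exp (real m))"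
        by (intro mult_right_mono) auto
      also have "\<dots> = 2 * (1 / 2 :: real) ^ m"
        by (simp add: power_divide exp_of_nat_mult[of m 1, simplified])
      finally show ?thesis .
    qed
    finally show ?thesis by (simp add: ennreal_leI)
  qed
  have "ennreal (exp ((Z \<omega>)\<^sup>2 / (2 * exp 1 * K\<^sup>2))) = (\<Sum>m. ennreal ((s * (Z \<omega>)\<^sup>2) ^ m / fact m))" for \<omega>
  proof -
    define x where "x = s * (Z \<omega>)\<^sup>2"
    have "(\<lambda>m. x ^ m / fact m) sums exp x"
      using exp_converges[of x] by (simp add: divide_inverse mult.commute)
    moreover have "0 \<le> x" using s by (simp add: x_def)
    ultimately have "(\<Sum>m. ennreal (x ^ m / fact m)) = ennreal (exp x)"
      by (intro suminf_ennreal_eq) auto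
    moreover have "(Z \<omega>)\<^sup>2 / (2 * exp 1 * K\<^sup>2) = x" by (simp add: x_def s_def)
    ultimately show ?thesis by (simp add: x_def)
  qed
  then have "(\<integral>\<^sup>+\<omega>. ennreal (exp ((Z \<omega>)\<^sup>2 / (2 * exp 1 * K\<^sup>2))) \<partial>M)
      = (\<Sum>m. \<integral>\<^sup>+\<omega>. ennreal ((s * (Z \<omega>)\<^sup>2) ^ m / fact m) \<partial>M)"
    by (simp add: nn_integral_suminf)
  also have "\<dots> \<le> (\<Sum>m. ennreal (2 * (1 / 2) ^ m))"
    by (intro suminf_le term_le) auto
  also have "\<dots> = ennreal 4"
    using sums_mult[OF geometric_sums[of "1 / 2 :: real"], of 2]
    by (intro suminf_ennreal_eq) auto
  finally show ?thesis by simp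
qed

text \<open>In the second-order expansion of exp the linear term has mean zero, since Z has second
  moment one. The exponent s \<bar>Z^2 - 1\<bar> is spent in two halves: one absorbs the square, the
  other absorbs exp \<bar>l (Z^2 - 1)\<bar>. This is why l is limited to half the radius.\<close>

lemma centered_square_mgf:
  assumes K: "0 < K" and Z: "unit_sub_gaussian_rv K Z" and l: "\<bar>l\<bar> \<le> mgf_radius K / 2"
  shows "integrable M (\<lambda>\<omega>. exp (l * ((Z \<omega>)\<^sup>2 - 1)))"
    and "expectation (\<lambda>\<omega>. exp (l * ((Z \<omega>)\<^sup>2 - 1))) \<le> exp (mgf_const K * l\<^sup>2)"
proof -
  define s where "s = mgf_radius K"
  have s: "0 < s" using K by (simp add: s_def mgf_radius_def)
  have [measurable]: "random_variable borel Z" using Z by (simp add: unit_sub_gaussian_rv_def)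
  have nn: "(\<integral>\<^sup>+\<omega>. ennreal (exp (s * (Z \<omega>)\<^sup>2)) \<partial>M) \<le> 4"
    using nn_integral_exp_square_le[OF K, of Z] Z
    by (simp add: unit_sub_gaussian_rv_def s_def mgf_radius_def)
  have I: "integrable M (\<lambda>\<omega>. exp (s * (Z \<omega>)\<^sup>2))"
    using nn by (intro integrableI_nonneg) (auto simp: less_top[symmetric] top_unique)
  have E: "expectation (\<lambda>\<omega>. exp (s * (Z \<omega>)\<^sup>2)) \<le> 4"
    using nn nn_integral_eq_integral[OF I] by (simp flip: ennreal_numeral)
  have I2: "integrable M (\<lambda>\<omega>. (Z \<omega>)\<^sup>2)"
  proof (rule Bochner_Integration.integrable_bound)
    show "integrable M (\<lambda>\<omega>. (1 / s) * exp (s * (Z \<omega>)\<^sup>2))" using I by simp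
    have "s * (Z \<omega>)\<^sup>2 \<le> exp (s * (Z \<omega>)\<^sup>2)" for \<omega> using exp_ge_add_one_self[of "s * (Z \<omega>)\<^sup>2"] by linarith
    then show "AE \<omega> in M. norm ((Z \<omega>)\<^sup>2) \<le> norm ((1 / s) * exp (s * (Z \<omega>)\<^sup>2))"
      using s by (auto simp: field_simps abs_mult)
  qed simp
  show int: "integrable M (\<lambda>\<omega>. exp (l * ((Z \<omega>)\<^sup>2 - 1)))"
  proof (rule Bochner_Integration.integrable_bound)
    show "integrable M (\<lambda>\<omega>. exp s * exp (s * (Z \<omega>)\<^sup>2))" using I by simp
    have "exp (l * ((Z \<omega>)\<^sup>2 - 1)) \<le> exp s * exp (s * (Z \<omega>)\<^sup>2)" for \<omega>
    proof -
      have "l * ((Z \<omega>)\<^sup>2 - 1) \<le> \<bar>l\<bar> * \<bar>(Z \<omega>)\<^sup>2 - 1\<bar>" by (metis abs_ge_self abs_mult)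
      also have "\<dots> \<le> s * ((Z \<omega>)\<^sup>2 + 1)" using l s
        by (intro mult_mono) (auto simp: s_def abs_le_iff)
      finally show ?thesis by (simp add: exp_add[symmetric] algebra_simps)
    qed
    then show "AE \<omega> in M. norm (exp (l * ((Z \<omega>)\<^sup>2 - 1))) \<le> norm (exp s * exp (s * (Z \<omega>)\<^sup>2))"
      by simp
  qed simp
  have pw: "exp (l * ((Z \<omega>)\<^sup>2 - 1))
      \<le> 1 + l * ((Z \<omega>)\<^sup>2 - 1) + l\<^sup>2 * (4 * exp s / s\<^sup>2) * exp (s * (Z \<omega>)\<^sup>2)" for \<omega>
  proof -
    define x where "x = (Z \<omega>)\<^sup>2 - 1"
    have ax: "\<bar>x\<bar> \<le> (Z \<omega>)\<^sup>2 + 1" by (auto simp: x_def abs_le_iff)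
    have "(s / 2 * \<bar>x\<bar>)\<^sup>2 / 2 \<le> exp (s / 2 * \<bar>x\<bar>)"
    proof -
      have "0 \<le> s / 2 * \<bar>x\<bar>" using s by simp
      then show ?thesis using exp_lower_Taylor_quadratic[of "s / 2 * \<bar>x\<bar>"] by linarith
    qed
    then have "x\<^sup>2 / 2 \<le> 4 / s\<^sup>2 * exp (s / 2 * \<bar>x\<bar>)"
      using s by (simp add: power_mult_distrib power_divide field_simps)
    moreover have "exp \<bar>l * x\<bar> \<le> exp (s / 2 * \<bar>x\<bar>)"
      using mult_right_mono[OF l abs_ge_zero[of x]] by (simp add: abs_mult s_def)
    ultimately have "x\<^sup>2 / 2 * exp \<bar>l * x\<bar> \<le> 4 / s\<^sup>2 * exp (s / 2 * \<bar>x\<bar>) * exp (s / 2 * \<bar>x\<bar>)"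
      by (intro mult_mono) auto
    also have "\<dots> = 4 / s\<^sup>2 * exp (s * \<bar>x\<bar>)" by (simp add: exp_add[symmetric])
    also have "\<dots> \<le> 4 / s\<^sup>2 * exp (s * ((Z \<omega>)\<^sup>2 + 1))" using ax s
      by (intro mult_left_mono) (auto intro!: mult_left_mono)
    also have "\<dots> = 4 * exp s / s\<^sup>2 * exp (s * (Z \<omega>)\<^sup>2)" by (simp add: algebra_simps exp_add)
    finally have "l\<^sup>2 * (x\<^sup>2 / 2 * exp \<bar>l * x\<bar>) \<le> l\<^sup>2 * (4 * exp s / s\<^sup>2 * exp (s * (Z \<omega>)\<^sup>2))"
      by (intro mult_left_mono) auto
    moreover have "exp (l * x) \<le> 1 + l * x + l\<^sup>2 * (x\<^sup>2 / 2 * exp \<bar>l * x\<bar>)"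
      using exp_le_quadratic[of "l * x"] by (simp add: power_mult_distrib)
    ultimately have "exp (l * x) \<le> 1 + l * x + l\<^sup>2 * (4 * exp s / s\<^sup>2 * exp (s * (Z \<omega>)\<^sup>2))"
      by linarith
    then show ?thesis unfolding x_def by (simp only: mult.assoc)
  qed
  have "expectation (\<lambda>\<omega>. exp (l * ((Z \<omega>)\<^sup>2 - 1)))
      \<le> expectation (\<lambda>\<omega>. 1 + l * ((Z \<omega>)\<^sup>2 - 1) + l\<^sup>2 * (4 * exp s / s\<^sup>2) * exp (s * (Z \<omega>)\<^sup>2))"
    using I I2 by (intro integral_mono int pw) auto
  also have "\<dots> = 1 + l * (expectation (\<lambda>\<omega>. (Z \<omega>)\<^sup>2) - 1)
      + l\<^sup>2 * (4 * exp s / s\<^sup>2) * expectation (\<lambda>\<omega>. exp (s * (Z \<omega>)\<^sup>2))"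
    using I I2 by (simp add: prob_space)
  also have "\<dots> \<le> 1 + l\<^sup>2 * (4 * exp s / s\<^sup>2) * 4"
    using Z mult_left_mono[OF E, of "l\<^sup>2 * (4 * exp s / s\<^sup>2)"] by (simp add: unit_sub_gaussian_rv_def)
  also have "\<dots> \<le> exp (mgf_const K * l\<^sup>2)"
    using exp_ge_add_one_self[of "mgf_const K * l\<^sup>2"] by (simp add: mgf_const_def s_def mult_ac)
  finally show "expectation (\<lambda>\<omega>. exp (l * ((Z \<omega>)\<^sup>2 - 1))) \<le> exp (mgf_const K * l\<^sup>2)" .
qed


lemma square_sum_upper_tail:
  fixes \<sigma> \<epsilon> :: real and Z :: "'i \<Rightarrow> 'a \<Rightarrow> real"
  assumes K: "0 < K" and J: "finite J" and ind: "indep_vars (\<lambda>_. borel) Z J"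
    and Z: "\<And>j. j \<in> J \<Longrightarrow> unit_sub_gaussian_rv K (Z j)" and \<epsilon>: "0 < \<epsilon>" "\<epsilon> < 1"
    and \<sigma>: "\<sigma> \<in> {- 1, 1}"
  shows "prob {\<omega> \<in> space M. \<epsilon> * card J \<le> \<sigma> * (\<Sum>j\<in>J. (Z j \<omega>)\<^sup>2 - 1)}
    \<le> exp (- (\<epsilon>\<^sup>2 * card J / (4 * mgf_const K)))"
proof -
  define C where "C = mgf_const K"
  have C: "0 < C" using mgf_const_pos[OF K] by (simp add: C_def)
  \<comment> \<open>Minimizes C l^2 - l \<epsilon>, with minimum - \<epsilon>^2 / (4 C). The sign
    \<sigma> does not affect l^2, so both tails share this choice.\<close>
  define l where "l = \<epsilon> / (2 * C)"
  have l: "0 < l" using \<epsilon> C by (simp add: l_def)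
  have "l \<le> 1 / C / 2" using \<epsilon> C by (simp add: l_def field_simps)
  also have "\<dots> \<le> mgf_radius K / 2" using inverse_mgf_const_le[OF K] by (simp add: C_def)
  finally have ls: "\<bar>l * \<sigma>\<bar> \<le> mgf_radius K / 2" using \<sigma> l by auto
  have ls2: "(l * \<sigma>)\<^sup>2 = l\<^sup>2" using \<sigma> by auto
  note mgf = centered_square_mgf[OF K Z ls]
  have indE: "indep_vars (\<lambda>_. borel) (\<lambda>j \<omega>. exp (l * \<sigma> * ((Z j \<omega>)\<^sup>2 - 1))) J"
    by (rule indep_vars_compose2[OF ind]) simp
  define W where "W \<omega> = \<sigma> * (\<Sum>j\<in>J. (Z j \<omega>)\<^sup>2 - 1)" for \<omega>
  have W: "exp (l * W \<omega>) = (\<Prod>j\<in>J. exp (l * \<sigma> * ((Z j \<omega>)\<^sup>2 - 1)))" for \<omega>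
    using J by (simp add: W_def exp_sum[symmetric] sum_distrib_left mult.assoc)
  have I: "integrable M (\<lambda>\<omega>. exp (l * W \<omega>))"
    unfolding W using indep_vars_integrable[OF J indE] mgf(1) by simp
  have "expectation (\<lambda>\<omega>. exp (l * W \<omega>)) = (\<Prod>j\<in>J. expectation (\<lambda>\<omega>. exp (l * \<sigma> * ((Z j \<omega>)\<^sup>2 - 1))))"
    unfolding W using indep_vars_lebesgue_integral[OF J indE] mgf(1) by simp
  also have "\<dots> \<le> (\<Prod>j\<in>J. exp (C * l\<^sup>2))"
    using mgf(2) by (intro prod_mono) (auto simp: C_def ls2 intro!: integral_nonneg_AE)
  also have "\<dots> = exp (C * l\<^sup>2 * card J)" by (simp add: exp_of_nat_mult[symmetric] mult.commute)
  finally have E: "expectation (\<lambda>\<omega>. exp (l * W \<omega>)) \<le> exp (C * l\<^sup>2 * card J)" .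
  have eq: "{\<omega> \<in> space M. \<epsilon> * card J \<le> W \<omega>} = {\<omega> \<in> space M. exp (l * (\<epsilon> * card J)) \<le> exp (l * W \<omega>)}"
    using l by auto
  have "prob {\<omega> \<in> space M. \<epsilon> * card J \<le> W \<omega>} \<le> expectation (\<lambda>\<omega>. exp (l * W \<omega>)) / exp (l * (\<epsilon> * card J))"
    unfolding eq by (rule integral_Markov_inequality_measure[where A="{}"]) (use I in auto)
  also have "\<dots> \<le> exp (C * l\<^sup>2 * card J) / exp (l * (\<epsilon> * card J))"
    using E by (intro divide_right_mono) auto
  also have "\<dots> = exp (- (\<epsilon>\<^sup>2 * card J / (4 * C)))"
    using C by (simp add: exp_diff[symmetric] l_def power2_eq_square field_simps)
  finally show ?thesis by (simp add: W_def C_def)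
qed

lemma square_sum_deviation:
  fixes \<epsilon> :: real and Z :: "'i \<Rightarrow> 'a \<Rightarrow> real"
  assumes K: "0 < K" and J: "finite J" and ind: "indep_vars (\<lambda>_. borel) Z J"
    and Z: "\<And>j. j \<in> J \<Longrightarrow> unit_sub_gaussian_rv K (Z j)" and \<epsilon>: "0 < \<epsilon>" "\<epsilon> < 1"
  shows "prob {\<omega> \<in> space M. \<epsilon> * card J < \<bar>\<Sum>j\<in>J. (Z j \<omega>)\<^sup>2 - 1\<bar>}
    \<le> 2 * exp (- (\<epsilon>\<^sup>2 * card J / (4 * mgf_const K)))"
proof -
  let ?A = "\<lambda>\<sigma>::real. {\<omega> \<in> space M. \<epsilon> * card J \<le> \<sigma> * (\<Sum>j\<in>J. (Z j \<omega>)\<^sup>2 - 1)}"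
  have [measurable]: "j \<in> J \<Longrightarrow> random_variable borel (Z j)" for j
    using Z by (simp add: unit_sub_gaussian_rv_def)
  have A: "?A \<sigma> \<in> events" for \<sigma> by measurable
  have "prob {\<omega> \<in> space M. \<epsilon> * card J < \<bar>\<Sum>j\<in>J. (Z j \<omega>)\<^sup>2 - 1\<bar>} \<le> prob (?A 1 \<union> ?A (- 1))"
    using A by (intro finite_measure_mono) auto
  also have "\<dots> \<le> prob (?A 1) + prob (?A (- 1))" by (rule measure_Un_le[OF A A])
  also have "\<dots> \<le> 2 * exp (- (\<epsilon>\<^sup>2 * card J / (4 * mgf_const K)))"
    using square_sum_upper_tail[OF assms, of 1] square_sum_upper_tail[OF assms, of "- 1"] by simp
  finally show ?thesis .
qed

section \<open>Linear combinations of independent sub-Gaussian variables\<close>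

lemma indep_sum_sub_gaussian:
  fixes X :: "'i \<Rightarrow> 'a \<Rightarrow> real"
  assumes I: "finite I" and ind: "indep_vars (\<lambda>_. borel) X I"
    and int: "\<And>i t. i \<in> I \<Longrightarrow> integrable M (\<lambda>\<omega>. exp (t * X i \<omega>))"
    and mgf: "\<And>i t. i \<in> I \<Longrightarrow> expectation (\<lambda>\<omega>. exp (t * X i \<omega>)) \<le> exp (s\<^sup>2 * t\<^sup>2 / 2)"
  shows "integrable M (\<lambda>\<omega>. exp (t * (\<Sum>i\<in>I. c i * X i \<omega>)))"
    and "expectation (\<lambda>\<omega>. exp (t * (\<Sum>i\<in>I. c i * X i \<omega>))) \<le> exp (s\<^sup>2 * (\<Sum>i\<in>I. (c i)\<^sup>2) * t\<^sup>2 / 2)"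
proof -
  have indE: "indep_vars (\<lambda>_. borel) (\<lambda>i \<omega>. exp (t * c i * X i \<omega>)) I"
    by (rule indep_vars_compose2[OF ind]) simp
  have W: "exp (t * (\<Sum>i\<in>I. c i * X i \<omega>)) = (\<Prod>i\<in>I. exp (t * c i * X i \<omega>))" for \<omega>
    using I by (simp add: exp_sum[symmetric] sum_distrib_left mult.assoc)
  show "integrable M (\<lambda>\<omega>. exp (t * (\<Sum>i\<in>I. c i * X i \<omega>)))"
    unfolding W using int by (intro indep_vars_integrable[OF I indE])
  have "expectation (\<lambda>\<omega>. exp (t * (\<Sum>i\<in>I. c i * X i \<omega>))) = (\<Prod>i\<in>I. expectation (\<lambda>\<omega>. exp (t * c i * X i \<omega>)))"
    unfolding W using int by (intro indep_vars_lebesgue_integral[OF I indE])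
  also have "\<dots> \<le> (\<Prod>i\<in>I. exp (s\<^sup>2 * (t * c i)\<^sup>2 / 2))"
    using mgf by (intro prod_mono) (auto intro!: integral_nonneg_AE)
  also have "\<dots> = exp (s\<^sup>2 * (\<Sum>i\<in>I. (c i)\<^sup>2) * t\<^sup>2 / 2)"
    using I by (simp add: exp_sum[symmetric] sum_distrib_left sum_distrib_right sum_divide_distrib power_mult_distrib mult_ac)
  finally show "expectation (\<lambda>\<omega>. exp (t * (\<Sum>i\<in>I. c i * X i \<omega>))) \<le> exp (s\<^sup>2 * (\<Sum>i\<in>I. (c i)\<^sup>2) * t\<^sup>2 / 2)" .
qed

lemma indep_sum_second_moment:
  fixes X :: "'i \<Rightarrow> 'a \<Rightarrow> real"
  assumes I: "finite I" and ind: "indep_vars (\<lambda>_. borel) X I"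
    and int: "\<And>i. i \<in> I \<Longrightarrow> integrable M (X i)" and int2: "\<And>i. i \<in> I \<Longrightarrow> integrable M (\<lambda>\<omega>. (X i \<omega>)\<^sup>2)"
    and mean: "\<And>i. i \<in> I \<Longrightarrow> expectation (X i) = 0"
    and var: "\<And>i. i \<in> I \<Longrightarrow> expectation (\<lambda>\<omega>. (X i \<omega>)\<^sup>2) = v"
  shows "expectation (\<lambda>\<omega>. (\<Sum>i\<in>I. c i * X i \<omega>)\<^sup>2) = v * (\<Sum>i\<in>I. (c i)\<^sup>2)"
proof -
  have prod: "integrable M (\<lambda>\<omega>. X i \<omega> * X j \<omega>) \<and> expectation (\<lambda>\<omega>. X i \<omega> * X j \<omega>) = (if i = j then v else 0)"
    if "i \<in> I" "j \<in> I" for i j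
  proof (cases "i = j")
    case True
    then show ?thesis using that int2 var by (simp add: power2_eq_square)
  next
    case False
    have ind2: "indep_vars (\<lambda>_. borel) X {i, j}" using that by (intro indep_vars_subset[OF ind]) auto
    have "integrable M (\<lambda>\<omega>. \<Prod>l\<in>{i, j}. X l \<omega>)"
      using that int by (intro indep_vars_integrable[OF _ ind2]) auto
    moreover have "expectation (\<lambda>\<omega>. \<Prod>l\<in>{i, j}. X l \<omega>) = (\<Prod>l\<in>{i, j}. expectation (X l))"
      using that int by (intro indep_vars_lebesgue_integral[OF _ ind2]) auto
    ultimately show ?thesis using False that mean by simp
  qed
  have "(\<Sum>i\<in>I. c i * X i \<omega>)\<^sup>2 = (\<Sum>i\<in>I. \<Sum>j\<in>I. c i * c j * (X i \<omega> * X j \<omega>))" for \<omega>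
    by (simp add: power2_eq_square sum_product mult_ac)
  then have "expectation (\<lambda>\<omega>. (\<Sum>i\<in>I. c i * X i \<omega>)\<^sup>2) = (\<Sum>i\<in>I. \<Sum>j\<in>I. c i * c j * (if i = j then v else 0))"
    using prod by simp
  also have "\<dots> = (\<Sum>i\<in>I. c i * c i * v)" using I by (simp add: if_distrib cong: if_cong)
  finally show ?thesis by (simp add: sum_distrib_left power2_eq_square mult_ac)
qed

end

section \<open>The law of the entries and the image of a single vector\<close>

lemma indep_vars_PiM_coordinates:
  assumes I: "finite I" "I \<noteq> {}" and M: "\<And>i. i \<in> I \<Longrightarrow> prob_space (M i)"
  shows "prob_space.indep_vars (PiM I M) M (\<lambda>i \<omega>. \<omega> i) I"
proof -
  interpret P: prob_space "PiM I M" by (rule prob_space_PiM[OF M])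
  \<comment> \<open>On the product space, restriction to I is the identity. The joint law of the
    coordinates is thus the product measure itself, which is what independence asks for.\<close>
  have "distr (PiM I M) (PiM I M) (\<lambda>x. \<lambda>i\<in>I. x i) = distr (PiM I M) (PiM I M) (\<lambda>x. x)"
    by (rule distr_cong) (auto simp: space_PiM PiE_iff extensional_restrict)
  also have "\<dots> = PiM I M" by simp
  also have "\<dots> = (\<Pi>\<^sub>M i\<in>I. distr (PiM I M) (M i) (\<lambda>x. x i))"
    using distr_PiM_component[of I M] M by (intro PiM_cong) auto
  finally show ?thesis using I by (subst P.indep_vars_iff_distr_eq_PiM') auto
qed

lemma entry_distributionD:
  assumes "entry_distribution K k D"
  shows "prob_space D" "sets D = sets borel" "integrable D (\<lambda>x. exp (t * x))"
    "(\<integral>x. exp (t * x) \<partial>D) \<le> exp ((K / sqrt k)\<^sup>2 * t\<^sup>2 / 2)"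
    "integrable D (\<lambda>x. x)" "(\<integral>x. x \<partial>D) = 0" "integrable D (\<lambda>x. x\<^sup>2)" "(\<integral>x. x\<^sup>2 \<partial>D) = 1 / k"
proof -
  show D: "prob_space D" and [measurable_cong]: "sets D = sets borel" and mean: "(\<integral>x. x \<partial>D) = 0"
    using assms by (auto simp: entry_distribution_def)
  interpret prob_space D by fact
  show int: "integrable D (\<lambda>x. exp (t * x))" for t
    using assms by (simp add: entry_distribution_def sub_gaussian_def)
  show "(\<integral>x. exp (t * x) \<partial>D) \<le> exp ((K / sqrt k)\<^sup>2 * t\<^sup>2 / 2)"
    using assms mean unfolding entry_distribution_def sub_gaussian_def by simp
  show "(\<integral>x. x\<^sup>2 \<partial>D) = 1 / k" using assms mean by (simp add: entry_distribution_def)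
  have I: "integrable D (\<lambda>x. exp x + exp (- x))"
    using int[of 1] int[of "- 1"] by simp
  have I2: "integrable D (\<lambda>x. 2 * (exp x + exp (- x)))"
    using I by (rule integrable_mult_right)
  show "integrable D (\<lambda>x. x)"
  proof (rule Bochner_Integration.integrable_bound[OF I])
    have "\<bar>x\<bar> \<le> exp x + exp (- x)" for x :: real
      using exp_ge_add_one_self[of x] exp_ge_add_one_self[of "- x"] exp_ge_zero[of x] exp_ge_zero[of "- x"]
      by linarith
    then show "AE x in D. norm x \<le> norm (exp x + exp (- x))"
      by (auto simp: abs_of_nonneg add_nonneg_nonneg)
  qed measurable
  show "integrable D (\<lambda>x. x\<^sup>2)"
  proof (rule Bochner_Integration.integrable_bound[OF I2])
    have "x\<^sup>2 \<le> 2 * (exp x + exp (- x))" for x :: real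
      using power_even_le_exp_sum[of x 1] by simp
    then show "AE x in D. norm (x\<^sup>2) \<le> norm (2 * (exp x + exp (- x)))"
      by (auto simp: abs_of_nonneg add_nonneg_nonneg)
  qed measurable
qed

lemma
  assumes "prob_space D"
  shows prob_space_iid_entries: "prob_space (iid_entries d k D)"
    and distr_iid_entries: "i < d \<Longrightarrow> j < k \<Longrightarrow> distr (iid_entries d k D) D (\<lambda>\<omega>. \<omega> (i, j)) = D"
  using assms by (auto simp: iid_entries_def intro!: prob_space_PiM distr_PiM_component)

lemma measurable_entry:
  assumes "sets D = sets borel" "i < d" "j < k"
  shows "(\<lambda>\<omega>. \<omega> (i, j)) \<in> borel_measurable (iid_entries d k D)"
proof -
  have "(\<lambda>\<omega>. \<omega> (i, j)) \<in> measurable (iid_entries d k D) D"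
    unfolding iid_entries_def using assms by (intro measurable_component_singleton) auto
  then show ?thesis by (simp add: measurable_cong_sets[OF refl assms(1)])
qed

text \<open>The coordinates of the image of a unit vector, times sqrt k, are independent with
  variance one and variance proxy K^2: the weights have square sum one, and sqrt k undoes the
  normalization of the entries.\<close>

lemma iid_column_deviation:
  fixes c :: "nat \<Rightarrow> real"
  assumes D: "entry_distribution K k D" and K: "0 < K" and k: "0 < k" and c: "(\<Sum>i<d. (c i)\<^sup>2) = 1"
    and \<epsilon>: "0 < \<epsilon>" "\<epsilon> < 1"
  defines "M \<equiv> iid_entries d k D"
  shows "\<P>(\<omega> in M. \<epsilon> < \<bar>(\<Sum>j<k. (\<Sum>i<d. c i * \<omega> (i, j))\<^sup>2) - 1\<bar>)
    \<le> 2 * exp (- (\<epsilon>\<^sup>2 * k / (4 * mgf_const K)))"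
proof -
  note D = entry_distributionD[OF D]
  interpret prob_space M unfolding M_def by (rule prob_space_iid_entries[OF D(1)])
  have d: "0 < d" using c by (cases d) auto
  have meas: "i < d \<Longrightarrow> j < k \<Longrightarrow> random_variable borel (\<lambda>\<omega>. \<omega> (i, j))" for i j
    unfolding M_def by (rule measurable_entry[OF D(2)])
  have measD: "i < d \<Longrightarrow> j < k \<Longrightarrow> (\<lambda>\<omega>. \<omega> (i, j)) \<in> measurable M D" for i j
    using meas measurable_cong_sets[OF refl D(2)] by blast
  have bD: "f \<in> borel_measurable borel \<Longrightarrow> f \<in> borel_measurable D" for f :: "real \<Rightarrow> real"
    using measurable_cong_sets[OF D(2) refl] by blast
  have expect: "expectation (\<lambda>\<omega>. f (\<omega> (i, j))) = (\<integral>x. f x \<partial>D)"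
    if "i < d" "j < k" "f \<in> borel_measurable borel" for i j and f :: "real \<Rightarrow> real"
    using integral_distr[OF measD[OF that(1,2)] bD[OF that(3)]] distr_iid_entries[OF D(1) that(1,2)]
    by (simp add: M_def)
  have integr: "integrable M (\<lambda>\<omega>. f (\<omega> (i, j)))"
    if "i < d" "j < k" "integrable D f" for i j and f :: "real \<Rightarrow> real"
    using integrable_distr[OF measD[OF that(1,2)], of f] distr_iid_entries[OF D(1) that(1,2)] that(3)
    by (simp add: M_def)
  have "indep_vars (\<lambda>_. D) (\<lambda>p \<omega>. \<omega> p) ({..<d} \<times> {..<k})"
    unfolding M_def iid_entries_def using d k D(1) by (intro indep_vars_PiM_coordinates) auto
  then have ind: "indep_vars (\<lambda>_. borel) (\<lambda>p \<omega>. \<omega> p) ({..<d} \<times> {..<k})"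
    by (rule indep_vars_compose2[where Y="\<lambda>_ x. x"]) (rule bD, simp)
  have ind_col: "indep_vars (\<lambda>_. borel) (\<lambda>i \<omega>. \<omega> (i, j)) {..<d}" if "j < k" for j
  proof -
    \<comment> \<open>Singleton blocks re-index the entries of column j by the row alone. In the
      proof of \<open>indZ\<close> whole columns are the blocks, so functions of distinct columns
      are independent.\<close>
    have "indep_vars (\<lambda>i. PiM {(i, j)} (\<lambda>_. borel)) (\<lambda>i \<omega>. restrict (\<lambda>p. \<omega> p) {(i, j)}) {..<d}"
      using that by (intro indep_vars_restrict[OF ind]) (auto simp: disjoint_family_on_def)
    from indep_vars_compose2[OF this, of "\<lambda>i x. x (i, j)" "\<lambda>_. borel"] show ?thesis by simp
  qed
  define Z where "Z j \<omega> = sqrt k * (\<Sum>i<d. c i * \<omega> (i, j))" for j and \<omega> :: "nat \<times> nat \<Rightarrow> real"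
  have indZ: "indep_vars (\<lambda>_. borel) Z {..<k}"
  proof -
    have "indep_vars (\<lambda>j. PiM ({..<d} \<times> {j}) (\<lambda>_. borel)) (\<lambda>j \<omega>. restrict (\<lambda>p. \<omega> p) ({..<d} \<times> {j})) {..<k}"
      by (intro indep_vars_restrict[OF ind]) (auto simp: disjoint_family_on_def)
    from indep_vars_compose2[OF this, of "\<lambda>j x. sqrt k * (\<Sum>i<d. c i * x (i, j))" "\<lambda>_. borel"]
    have "indep_vars (\<lambda>_. borel) (\<lambda>j \<omega>. sqrt k * (\<Sum>i<d. c i * restrict \<omega> ({..<d} \<times> {j}) (i, j))) {..<k}"
      by simp
    then show ?thesis unfolding Z_def by simp
  qed
  have Z: "unit_sub_gaussian_rv K (Z j)" if j: "j < k" for j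
  proof -
    note sg = indep_sum_sub_gaussian[OF finite_lessThan ind_col[OF j], where s="K / sqrt k" and c=c]
    have 1: "integrable M (\<lambda>\<omega>. exp (t * \<omega> (i, j)))" if "i < d" for i t
      using integr[OF that j D(3)] .
    have 2: "expectation (\<lambda>\<omega>. exp (t * \<omega> (i, j))) \<le> exp ((K / sqrt k)\<^sup>2 * t\<^sup>2 / 2)" if "i < d" for i t
      using expect[OF that j, of "\<lambda>x. exp (t * x)"] D(4)[of t] by simp
    have "integrable M (\<lambda>\<omega>. exp (t * Z j \<omega>))" for t
      using sg(1)[of "t * sqrt k"] 1 2 by (simp add: Z_def mult.assoc)
    moreover have "expectation (\<lambda>\<omega>. exp (t * Z j \<omega>)) \<le> exp (K\<^sup>2 * t\<^sup>2 / 2)" for t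
      using sg(2)[of "t * sqrt k"] 1 2 k c by (simp add: Z_def mult.assoc power_mult_distrib power_divide)
    moreover have "expectation (\<lambda>\<omega>. (Z j \<omega>)\<^sup>2) = 1"
    proof -
      have "expectation (\<lambda>\<omega>. (\<Sum>i<d. c i * \<omega> (i, j))\<^sup>2) = 1 / k * (\<Sum>i<d. (c i)\<^sup>2)"
        using expect[OF _ j, of _ "\<lambda>x. x"] expect[OF _ j, of _ "\<lambda>x. x\<^sup>2"] integr[OF _ j D(5)] integr[OF _ j D(7)] D(6,8)
        by (intro indep_sum_second_moment[OF finite_lessThan ind_col[OF j]]) auto
      then show ?thesis using k c by (simp add: Z_def power_mult_distrib)
    qed
    moreover have "random_variable borel (Z j)"
      unfolding Z_def using meas j by (auto intro!: borel_measurable_times borel_measurable_sum)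
    ultimately show ?thesis by (simp add: unit_sub_gaussian_rv_def)
  qed
  have "(\<Sum>j<k. (Z j \<omega>)\<^sup>2 - 1) = k * ((\<Sum>j<k. (\<Sum>i<d. c i * \<omega> (i, j))\<^sup>2) - 1)" for \<omega>
  proof -
    have "(Z j \<omega>)\<^sup>2 = k * (\<Sum>i<d. c i * \<omega> (i, j))\<^sup>2" for j by (simp add: Z_def power_mult_distrib)
    then show ?thesis by (simp add: sum_subtractf right_diff_distrib flip: sum_distrib_left)
  qed
  then have "{\<omega> \<in> space M. \<epsilon> < \<bar>(\<Sum>j<k. (\<Sum>i<d. c i * \<omega> (i, j))\<^sup>2) - 1\<bar>}
      = {\<omega> \<in> space M. \<epsilon> * card {..<k} < \<bar>\<Sum>j<k. (Z j \<omega>)\<^sup>2 - 1\<bar>}"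
    using k by (simp add: abs_mult mult.commute[of \<epsilon>])
  then show ?thesis
    using square_sum_deviation[OF K finite_lessThan indZ _ \<epsilon>] Z by simp
qed

subsection \<open>Quadratic forms and lattice nets\<close>

definition sq_norm :: "nat \<Rightarrow> (nat \<Rightarrow> real) \<Rightarrow> real" where
  "sq_norm m a = (\<Sum>i<m. (a i)\<^sup>2)"

definition quad_form :: "nat \<Rightarrow> (nat \<Rightarrow> nat \<Rightarrow> real) \<Rightarrow> (nat \<Rightarrow> real) \<Rightarrow> real" where
  "quad_form m A a = (\<Sum>i<m. \<Sum>j<m. A i j * a i * a j)"

lemma sq_norm_nonneg: "0 \<le> sq_norm m a"
  by (simp add: sq_norm_def sum_nonneg)

lemma quad_form_scale: "quad_form m A (\<lambda>i. c * a i) = c\<^sup>2 * quad_form m A a"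
  by (simp add: quad_form_def sum_distrib_left power2_eq_square mult_ac)

lemma sq_norm_scale: "sq_norm m (\<lambda>i. c * a i) = c\<^sup>2 * sq_norm m a"
  by (simp add: sq_norm_def sum_distrib_left power_mult_distrib)

lemma sq_norm_parallelogram:
  "sq_norm m (\<lambda>i. a i + b i) + sq_norm m (\<lambda>i. a i - b i) = 2 * (sq_norm m a + sq_norm m b)"
  unfolding sq_norm_def sum.distrib[symmetric] sum_distrib_left
  by (intro sum.cong refl) (simp add: power2_eq_square algebra_simps)

lemma quad_form_entry_bound: "\<bar>quad_form m A a\<bar> \<le> (\<Sum>i<m. \<Sum>j<m. \<bar>A i j\<bar>) * sq_norm m a"
proof -
  have a2: "(a i)\<^sup>2 \<le> sq_norm m a" if "i < m" for i
    unfolding sq_norm_def using that by (intro member_le_sum) auto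
  have "\<bar>A i j * a i * a j\<bar> \<le> \<bar>A i j\<bar> * sq_norm m a" if "i < m" "j < m" for i j
  proof -
    have "0 \<le> (\<bar>a i\<bar> - \<bar>a j\<bar>)\<^sup>2" by simp
    then have "2 * (\<bar>a i\<bar> * \<bar>a j\<bar>) \<le> (a i)\<^sup>2 + (a j)\<^sup>2" by (simp add: power2_diff)
    then have "\<bar>a i\<bar> * \<bar>a j\<bar> \<le> sq_norm m a" using a2[of i] a2[of j] that by linarith
    then show ?thesis by (simp add: abs_mult mult.assoc mult_left_mono)
  qed
  then have "(\<Sum>i<m. \<Sum>j<m. \<bar>A i j * a i * a j\<bar>) \<le> (\<Sum>i<m. \<Sum>j<m. \<bar>A i j\<bar> * sq_norm m a)"
    by (intro sum_mono) auto
  moreover have "\<bar>quad_form m A a\<bar> \<le> (\<Sum>i<m. \<Sum>j<m. \<bar>A i j * a i * a j\<bar>)"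
    unfolding quad_form_def by (intro order_trans[OF sum_abs] sum_mono) auto
  ultimately show ?thesis by (simp add: sum_distrib_right)
qed

text \<open>One pass of the bootstrap: on the unit sphere the form differs from its value at a
  nearby net point by at most M / 4, and homogeneity of degree two extends the bound to all
  vectors.\<close>

lemma quad_form_bound_improve:
  assumes net: "\<And>a. sq_norm m a = 1 \<Longrightarrow> \<exists>b. \<bar>quad_form m A b\<bar> \<le> \<eta> \<and> sq_norm m b \<le> 1 \<and> sq_norm m (\<lambda>i. a i - b i) \<le> 1 / 64"
    and M: "0 \<le> M" "\<And>a. \<bar>quad_form m A a\<bar> \<le> M * sq_norm m a"
  shows "\<bar>quad_form m A a\<bar> \<le> (\<eta> + M / 2) * sq_norm m a"
proof (cases "sq_norm m a = 0")
  case True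
  then show ?thesis using M(2)[of a] by simp
next
  case False
  have unit: "\<bar>quad_form m A a\<bar> \<le> \<eta> + M / 2" if a: "sq_norm m a = 1" for a
  proof -
    obtain b where b: "\<bar>quad_form m A b\<bar> \<le> \<eta>" "sq_norm m b \<le> 1" "sq_norm m (\<lambda>i. a i - b i) \<le> 1 / 64"
      using net[OF a] by blast
    \<comment> \<open>The polarization identity below tolerates any scaling of u against v with the
      same product. The factors 4 and 1 / 4 balance \<bar>a - b\<bar> \<le> 1 / 8 against \<bar>a +
      b\<bar> \<le> 2: both squared norms become at most 1 / 4, and their sum, doubled by the
      parallelogram law, is at most 1.\<close>
    define u where "u i = 4 * (a i - b i)" for i
    define v where "v i = 1 / 4 * (a i + b i)" for i
    have "4 * (quad_form m A a - quad_form m A b) = quad_form m A (\<lambda>i. u i + v i) - quad_form m A (\<lambda>i. u i - v i)"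
    proof -
      have "4 * (A i j * a i * a j - A i j * b i * b j)
          = A i j * (u i + v i) * (u j + v j) - A i j * (u i - v i) * (u j - v j)" for i j
        unfolding u_def v_def by (simp add: field_simps)
      then show ?thesis
        unfolding quad_form_def sum_subtractf[symmetric] sum_distrib_left by (intro sum.cong refl)
    qed
    also have "\<bar>\<dots>\<bar> \<le> M * (sq_norm m (\<lambda>i. u i + v i) + sq_norm m (\<lambda>i. u i - v i))"
      using M(2)[of "\<lambda>i. u i + v i"] M(2)[of "\<lambda>i. u i - v i"] by (simp add: distrib_left)
    also have "\<dots> = M * (2 * (16 * sq_norm m (\<lambda>i. a i - b i) + sq_norm m (\<lambda>i. a i + b i) / 16))"
      unfolding sq_norm_parallelogram u_def v_def sq_norm_scale by (simp add: power2_eq_square)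
    also have "\<dots> \<le> M * 1"
      using b a sq_norm_parallelogram[of m a b] sq_norm_nonneg[of m "\<lambda>i. a i - b i"]
      by (intro mult_left_mono M) auto
    finally have "\<bar>quad_form m A a - quad_form m A b\<bar> \<le> M / 4" unfolding abs_mult by simp
    then show ?thesis using b(1) M(1) by linarith
  qed
  define t where "t = sqrt (sq_norm m a)"
  have t: "0 < t" "t\<^sup>2 = sq_norm m a" using False sq_norm_nonneg[of m a] by (simp_all add: t_def)
  have "\<bar>quad_form m A (\<lambda>i. 1 / t * a i)\<bar> \<le> \<eta> + M / 2"
    by (rule unit, unfold sq_norm_scale) (use t False in \<open>simp add: power_divide\<close>)
  then have "\<bar>quad_form m A a\<bar> / t\<^sup>2 \<le> \<eta> + M / 2"
    unfolding quad_form_scale by (simp add: power_divide abs_mult)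
  then have "\<bar>quad_form m A a\<bar> \<le> (\<eta> + M / 2) * t\<^sup>2" using t(1) by (simp add: pos_divide_le_eq)
  then show ?thesis using t(2) by simp
qed

text \<open>\<open>2 * \<eta>\<close> is the fixed point of the map sending M to \<eta> + M / 2. The
  excess over it halves in each pass and vanishes in the limit.\<close>

lemma quad_form_bound_net:
  assumes "\<And>a. sq_norm m a = 1 \<Longrightarrow> \<exists>b. \<bar>quad_form m A b\<bar> \<le> \<eta> \<and> sq_norm m b \<le> 1 \<and> sq_norm m (\<lambda>i. a i - b i) \<le> 1 / 64"
    and \<eta>: "0 \<le> \<eta>"
  shows "\<bar>quad_form m A a\<bar> \<le> 2 * \<eta> * sq_norm m a"
proof -
  define M where "M = (\<Sum>i<m. \<Sum>j<m. \<bar>A i j\<bar>)"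
  have M: "0 \<le> M" by (simp add: M_def sum_nonneg)
  have "\<bar>quad_form m A a\<bar> \<le> (2 * \<eta> + M * (1 / 2) ^ t) * sq_norm m a" for t :: nat and a
  proof (induction t arbitrary: a)
    case 0
    have "M * sq_norm m a \<le> (2 * \<eta> + M) * sq_norm m a"
      using \<eta> sq_norm_nonneg by (intro mult_right_mono) auto
    then show ?case using quad_form_entry_bound[of m A a] by (simp add: M_def)
  next
    case (Suc t)
    have "\<bar>quad_form m A a\<bar> \<le> (\<eta> + (2 * \<eta> + M * (1 / 2) ^ t) / 2) * sq_norm m a"
      using M \<eta> by (intro quad_form_bound_improve assms(1) Suc.IH) auto
    then show ?case by (simp add: field_simps)
  qed
  moreover have "(\<lambda>t. (2 * \<eta> + M * (1 / 2) ^ t) * sq_norm m a) \<longlonglongrightarrow> (2 * \<eta> + M * 0) * sq_norm m a"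
    by (intro tendsto_intros LIMSEQ_power_zero) auto
  ultimately show ?thesis by (intro LIMSEQ_le_const) auto
qed

section \<open>Lattice points in a ball and the resulting net\<close>

lemma sum_half_powers: "(\<Sum>z\<in>{- int L..int L}. (1 / 2 :: real) ^ nat \<bar>z\<bar>) = 3 - 2 * (1 / 2) ^ L"
proof (induction L)
  case (Suc L)
  have "{- int (Suc L)..int (Suc L)} = insert (- int (Suc L)) (insert (int (Suc L)) {- int L..int L})"
    by auto
  then show ?case using Suc by (simp add: nat_add_distrib)
qed simp

text \<open>The lattice points of a ball of radius \<open>sqrt (s m)\<close> are counted with the weight
  \<open>2\<close> to the power \<open>- (\<bar>z 0\<bar> + \<dots> + \<bar>z (m - 1)\<bar>)\<close>, whose total mass factorizes.\<close>

lemma card_lattice_ball_le: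
  fixes m s :: nat
  defines "Z \<equiv> {z \<in> {..<m} \<rightarrow>\<^sub>E {- int (s * m)..int (s * m)}. (\<Sum>i<m. (z i)\<^sup>2) \<le> int (s * m)}"
  shows "finite Z" and "real (card Z) \<le> 2 ^ ((s + 2) * m)"
proof -
  define w where "w z = (\<Prod>i<m. (1 / 2 :: real) ^ nat \<bar>z i\<bar>)" for z :: "nat \<Rightarrow> int"
  define P where "P = {..<m} \<rightarrow>\<^sub>E {- int (s * m)..int (s * m)}"
  have P: "finite P" by (simp add: P_def finite_PiE)
  have ZP: "Z \<subseteq> P" by (auto simp: Z_def P_def)
  then show "finite Z" using P by (rule finite_subset)
  \<comment> \<open>An integer is at most its square in absolute value, so the sum of the absolute
    values is at most s m on the ball, and no point of it weighs less than 2^(- s m).\<close>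
  have wZ: "1 \<le> 2 ^ (s * m) * w z" if "z \<in> Z" for z
  proof -
    have "\<bar>x\<bar> \<le> x\<^sup>2" for x :: int
      using mult_left_mono[of 1 "\<bar>x\<bar>" "\<bar>x\<bar>"] by (cases "x = 0") (auto simp: power2_eq_square abs_mult_self_eq)
    then have "int (\<Sum>i<m. nat \<bar>z i\<bar>) \<le> (\<Sum>i<m. (z i)\<^sup>2)" by (simp add: sum_mono)
    also have "\<dots> \<le> int (s * m)" using that by (simp add: Z_def)
    finally have "(\<Sum>i<m. nat \<bar>z i\<bar>) \<le> s * m" by linarith
    then have "(1 / 2 :: real) ^ (s * m) \<le> (1 / 2) ^ (\<Sum>i<m. nat \<bar>z i\<bar>)" by (intro power_decreasing) auto
    also have "\<dots> = w z" by (simp add: w_def power_sum)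
    finally show ?thesis by (simp add: power_divide field_simps)
  qed
  have w0: "0 \<le> w z" for z by (simp add: w_def prod_nonneg)
  have "real (card Z) = (\<Sum>z\<in>Z. 1)" by simp
  also have "\<dots> \<le> (\<Sum>z\<in>Z. 2 ^ (s * m) * w z)" by (intro sum_mono wZ)
  also have "\<dots> \<le> (\<Sum>z\<in>P. 2 ^ (s * m) * w z)" using P ZP w0 by (intro sum_mono2) auto
  also have "\<dots> = 2 ^ (s * m) * (\<Prod>i<m. \<Sum>x\<in>{- int (s * m)..int (s * m)}. (1 / 2 :: real) ^ nat \<bar>x\<bar>)"
    unfolding P_def w_def sum_distrib_left[symmetric] by (subst prod_sum_PiE) auto
  \<comment> \<open>Each one-dimensional sum is below 3; rounding it up to 4 = 2^2 gives the summand
    2 in the exponent (s + 2) m.\<close>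
  also have "\<dots> \<le> 2 ^ (s * m) * (\<Prod>i<m. 4)"
  proof -
    have "(1 / 2 :: real) ^ (s * m) \<le> 1" "0 \<le> (1 / 2 :: real) ^ (s * m)" by (auto intro: power_le_one)
    then have "0 \<le> 3 - 2 * (1 / 2 :: real) ^ (s * m)" "3 - 2 * (1 / 2 :: real) ^ (s * m) \<le> 4" by linarith+
    then show ?thesis unfolding sum_half_powers by (intro mult_left_mono prod_mono conjI) auto
  qed
  also have "\<dots> = 2 ^ (s * m) * 2 ^ (2 * m)" by (simp add: power_mult)
  also have "\<dots> = 2 ^ ((s + 2) * m)" by (simp add: power_add[symmetric] algebra_simps)
  finally show "real (card Z) \<le> 2 ^ ((s + 2) * m)" .
qed

text \<open>Rounding towards zero rather than to the nearest integer never lengthens a vector, so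
  net points stay in the unit ball.\<close>

lemma round_to_zero:
  fixes x :: real
  obtains z :: int where "\<bar>of_int z\<bar> \<le> \<bar>x\<bar>" "\<bar>x - of_int z\<bar> \<le> 1"
proof (cases "0 \<le> x")
  case True
  show ?thesis by (rule that[of "\<lfloor>x\<rfloor>"]) (use True of_int_floor_le[of x] zero_le_floor[of x] real_of_int_floor_add_one_gt[of x] in linarith)+
next
  case False
  show ?thesis by (rule that[of "\<lceil>x\<rceil>"]) (use False le_of_int_ceiling[of x] ceiling_le_zero[of x] of_int_ceiling_diff_one_le[of x] in linarith)+
qed

lemma unit_ball_net:
  assumes m: "0 < m"
  obtains N where "finite N" "real (card N) \<le> 2 ^ (66 * m)"
    "\<And>a. sq_norm m a \<le> 1 \<Longrightarrow> \<exists>b\<in>N. sq_norm m b \<le> 1 \<and> sq_norm m (\<lambda>i. a i - b i) \<le> 1 / 64"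
proof
  define Z where "Z = {z \<in> {..<m} \<rightarrow>\<^sub>E {- int (64 * m)..int (64 * m)}. (\<Sum>i<m. (z i)\<^sup>2) \<le> int (64 * m)}"
  \<comment> \<open>With this mesh width, m coordinate errors add up to a squared distance of at
    most m / (64 m) = 1 / 64. In lattice units the unit ball has squared radius 64 m, hence s = 64
    and the exponent 66 = 64 + 2.\<close>
  define g :: "(nat \<Rightarrow> int) \<Rightarrow> nat \<Rightarrow> real" where "g z i = 1 / (8 * sqrt m) * of_int (z i)" for z i
  note Z = card_lattice_ball_le[where s=64 and m=m, folded Z_def]
  show "finite (g ` Z)" using Z(1) by simp
  have "real (card (g ` Z)) \<le> real (card Z)" using Z(1) card_image_le by simp
  then show "real (card (g ` Z)) \<le> 2 ^ (66 * m)" using Z(2) by simp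
  fix a assume a: "sq_norm m a \<le> 1"
  define x where "x i = 8 * sqrt m * a i" for i
  have "\<forall>i. \<exists>z :: int. \<bar>of_int z\<bar> \<le> \<bar>x i\<bar> \<and> \<bar>x i - of_int z\<bar> \<le> 1"
    using round_to_zero by metis
  then obtain z :: "nat \<Rightarrow> int" where z: "\<And>i. \<bar>of_int (z i)\<bar> \<le> \<bar>x i\<bar>" "\<And>i. \<bar>x i - of_int (z i)\<bar> \<le> 1"
    by metis
  have sq: "(of_int (z i))\<^sup>2 \<le> (x i)\<^sup>2" "(x i - of_int (z i))\<^sup>2 \<le> 1" for i
    using power_mono[OF z(1)[of i], of 2] power_mono[OF z(2)[of i], of 2] by simp_all
  have x: "sq_norm m x = 64 * m * sq_norm m a"
    unfolding x_def sq_norm_scale by (simp add: power_mult_distrib)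
  have zx: "(\<Sum>i<m. (of_int (z i))\<^sup>2) \<le> sq_norm m x"
    unfolding sq_norm_def by (intro sum_mono sq)
  also have "\<dots> \<le> 64 * m" using a x m by simp
  finally have "real_of_int (\<Sum>i<m. (z i)\<^sup>2) \<le> real_of_int (int (64 * m))" by simp
  then have z2: "(\<Sum>i<m. (z i)\<^sup>2) \<le> int (64 * m)" by (simp only: of_int_le_iff)
  have zi: "\<bar>z i\<bar> \<le> int (64 * m)" if "i < m" for i
  proof -
    have "\<bar>z i\<bar> \<le> (z i)\<^sup>2"
      using mult_left_mono[of 1 "\<bar>z i\<bar>" "\<bar>z i\<bar>"] by (cases "z i = 0") (auto simp: power2_eq_square abs_mult_self_eq)
    also have "\<dots> \<le> (\<Sum>i<m. (z i)\<^sup>2)" using that by (intro member_le_sum) auto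
    finally show ?thesis using z2 by linarith
  qed
  \<comment> \<open>Members of Z are extensional functions, so z is cut off outside the first m
    indices; \<open>sq_norm m\<close> reads only these.\<close>
  have "restrict z {..<m} \<in> Z"
    using z2 abs_le_D1[OF zi] abs_le_D2[OF zi] by (auto simp: Z_def) (metis minus_le_iff)
  moreover have "sq_norm m (g (restrict z {..<m})) \<le> 1"
  proof -
    have "sq_norm m (g (restrict z {..<m})) = sq_norm m (\<lambda>i. 1 / (8 * sqrt m) * of_int (z i))"
      by (simp add: sq_norm_def g_def)
    also have "\<dots> = (1 / (8 * sqrt m))\<^sup>2 * (\<Sum>i<m. (of_int (z i))\<^sup>2)"
      unfolding sq_norm_scale by (simp add: sq_norm_def)
    also have "\<dots> \<le> (1 / (8 * sqrt m))\<^sup>2 * (64 * m * sq_norm m a)"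
      using zx x by (intro mult_left_mono) auto
    also have "\<dots> \<le> 1" using m a by (simp add: power_divide power_mult_distrib)
    finally show ?thesis .
  qed
  moreover have "sq_norm m (\<lambda>i. a i - g (restrict z {..<m}) i) \<le> 1 / 64"
  proof -
    have "a i - g z i = 1 / (8 * sqrt m) * (x i - of_int (z i))" for i
      using m by (simp add: g_def x_def field_simps)
    then have "sq_norm m (\<lambda>i. a i - g (restrict z {..<m}) i) = sq_norm m (\<lambda>i. 1 / (8 * sqrt m) * (x i - of_int (z i)))"
      by (simp add: sq_norm_def g_def)
    also have "\<dots> = (1 / (8 * sqrt m))\<^sup>2 * (\<Sum>i<m. (x i - of_int (z i))\<^sup>2)"
      unfolding sq_norm_scale by (simp add: sq_norm_def)
    also have "\<dots> \<le> (1 / (8 * sqrt m))\<^sup>2 * (\<Sum>i<m. 1)"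
      using sq by (intro mult_left_mono sum_mono) auto
    also have "\<dots> = 1 / 64" using m by (simp add: power_divide power_mult_distrib)
    finally show ?thesis .
  qed
  ultimately show "\<exists>b\<in>g ` Z. sq_norm m b \<le> 1 \<and> sq_norm m (\<lambda>i. a i - b i) \<le> 1 / 64" by blast
qed

subsection \<open>Orthonormal bases of subspaces\<close>

lemma subspace_basis:
  assumes V: "linear_subspace d r V"
  obtains B where "finite B" "B \<subseteq> carrier_vec d" "card B = r"
    "\<not> LinearCombinations.module.lin_dep class_ring (module_vec TYPE(real) d) B"
    "LinearCombinations.module.span class_ring (module_vec TYPE(real) d) B = V"
proof -
  interpret vec_space "TYPE(real)" d .
  have sub: "VectorSpace.subspace class_ring V (module_vec TYPE(real) d)"
    and r: "vectorspace.dim class_ring (vs V) = r"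
    using V by (auto simp: linear_subspace_def)
  have smod: "submodule class_ring V (module_vec TYPE(real) d)" using sub by (rule is_module)
  then have VC: "V \<subseteq> carrier_vec d" by (auto simp: submodule_def)
  interpret W: vectorspace class_ring "vs V" using sub by (rule subspace_is_vs)
  have P: "finite A \<and> card A \<le> dim" if "A \<subseteq> V \<and> \<not> W.lin_dep A" for A
    using that VC li_le_dim[of A] span_li_not_depend(2)[OF _ smod, of A] fin_dim by auto
  have "\<not> W.lin_dep {}" by (simp add: W.lin_dep_def)
  \<comment> \<open>Independence in V is independence in the ambient space, so the sizes are bounded
    by the ambient dimension. A maximal independent set therefore exists, and it is a basis of
    V.\<close>
  then have "\<exists>A. finite A \<and> maximal A (\<lambda>A. A \<subseteq> V \<and> \<not> W.lin_dep A)"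
    by (intro maximal_exists[where B="{}" and N=dim] P) auto
  then obtain B where B: "finite B" "maximal B (\<lambda>A. A \<subseteq> carrier (vs V) \<and> \<not> W.lin_dep A)"
    by auto
  have basis: "W.basis B" using B(2) by (rule W.max_li_is_basis)
  have BV: "B \<subseteq> V" using basis by (auto simp: W.basis_def)
  show ?thesis
  proof
    show "finite B" by fact
    show "B \<subseteq> carrier_vec d" using BV VC by auto
    show "card B = r" using W.dim_basis[OF B(1) basis] r by simp
    show "\<not> lin_dep B" using basis span_li_not_depend(2)[OF BV smod] by (auto simp: W.basis_def)
    show "span B = V" using basis span_li_not_depend(1)[OF BV smod] by (auto simp: W.basis_def)
  qed
qed

text \<open>Parametrizes the subspace isometrically by coefficient functions of which only the first
  r values matter, the form in which quadratic forms and nets are stated.\<close>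

lemma subspace_orthonormal_basis:
  assumes "linear_subspace d r V"
  obtains u :: "nat \<Rightarrow> nat \<Rightarrow> real" where
    "\<forall>i<r. \<forall>j<r. (\<Sum>l<d. u i l * u j l) = (if i = j then 1 else 0)"
    "V = range (\<lambda>a. Matrix.vec d (\<lambda>l. \<Sum>i<r. a i * u i l))"
proof -
  interpret cof_vec_space d "TYPE(real)" .
  obtain B where B: "finite B" "B \<subseteq> carrier_vec d" "card B = r" "\<not> lin_dep B" "span B = V"
    using subspace_basis[OF assms] by metis
  obtain ws where ws: "set ws = B" "distinct ws" using finite_distinct_list[OF B(1)] by blast
  define us where "us = gram_schmidt d ws"
  have gs: "span (set us) = V" "corthogonal us" "set us \<subseteq> carrier_vec d" "length us = r"
    using gram_schmidt_result[of ws us] B ws distinct_card[OF ws(2)] by (auto simp: us_def)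
  have dim: "dim_vec (us ! i) = d" if "i < r" for i
  proof -
    have "us ! i \<in> set us" using that gs(4) by simp
    then show ?thesis using gs(3) carrier_vecD by blast
  qed
  have sp: "us ! i \<bullet> us ! j = (\<Sum>l<d. us ! i $ l * us ! j $ l)" if "j < r" for i j
    using dim[OF that] by (simp add: scalar_prod_def lessThan_atLeast0)
  have orth: "us ! i \<bullet> us ! j = 0 \<longleftrightarrow> i \<noteq> j" if "i < r" "j < r" for i j
    using corthogonalD[OF gs(2)] that gs(4) by simp
  \<comment> \<open>Gram-Schmidt does not normalize. These lengths are nonzero because
    \<open>corthogonal\<close> also says that no vector of the list is orthogonal to itself.\<close>
  define \<nu> where "\<nu> i = sqrt (us ! i \<bullet> us ! i)" for i
  have \<nu>: "\<nu> i * \<nu> i = us ! i \<bullet> us ! i" "\<nu> i \<noteq> 0" if "i < r" for i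
  proof -
    have "0 \<le> us ! i \<bullet> us ! i" unfolding sp[OF that] by (intro sum_nonneg) simp
    then show "\<nu> i * \<nu> i = us ! i \<bullet> us ! i" by (simp add: \<nu>_def)
    then show "\<nu> i \<noteq> 0" using orth[OF that that] by auto
  qed
  define u where "u i l = us ! i $ l / \<nu> i" for i l
  show ?thesis
  proof (rule that, intro allI impI)
    fix i j assume ij: "i < r" "j < r"
    have "(\<Sum>l<d. u i l * u j l) = (us ! i \<bullet> us ! j) / (\<nu> i * \<nu> j)"
      unfolding sp[OF ij(2)] by (simp add: u_def sum_divide_distrib)
    then show "(\<Sum>l<d. u i l * u j l) = (if i = j then 1 else 0)"
      using orth[OF ij] \<nu>[OF ij(1)] by auto
  next
    have comb: "lincomb_list c us = Matrix.vec d (\<lambda>l. \<Sum>i<r. c i * us ! i $ l)" for c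
    proof -
      have "lincomb_list c us = mat_of_cols d us *\<^sub>v Matrix.vec r c"
      proof -
        have "\<forall>w\<in>set us. dim_vec w = d" using gs(3) carrier_vecD by blast
        then show ?thesis using lincomb_list_as_mat_mult[of us c] gs(4) by simp
      qed
      then show ?thesis
        by (auto simp: gs(4) scalar_prod_def mat_of_cols_def lessThan_atLeast0 mult.commute intro!: eq_vecI sum.cong)
    qed
    have "V = range (\<lambda>c. Matrix.vec d (\<lambda>l. \<Sum>i<r. c i * us ! i $ l))"
      unfolding gs(1)[symmetric] span_list_as_span[OF gs(3), symmetric] span_list_def comb by auto
    also have "\<dots> = range (\<lambda>a. Matrix.vec d (\<lambda>l. \<Sum>i<r. a i * u i l))"
    proof (intro equalityI subsetI)
      fix v assume "v \<in> range (\<lambda>c. Matrix.vec d (\<lambda>l. \<Sum>i<r. c i * us ! i $ l))"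
      then obtain c where c: "v = Matrix.vec d (\<lambda>l. \<Sum>i<r. c i * us ! i $ l)" by blast
      have "v = Matrix.vec d (\<lambda>l. \<Sum>i<r. (c i * \<nu> i) * u i l)"
        unfolding c u_def using \<nu>(2) by (auto intro!: eq_vecI sum.cong)
      then show "v \<in> range (\<lambda>a. Matrix.vec d (\<lambda>l. \<Sum>i<r. a i * u i l))"
        by (intro image_eqI[where x="\<lambda>i. c i * \<nu> i"]) auto
    next
      fix v assume "v \<in> range (\<lambda>a. Matrix.vec d (\<lambda>l. \<Sum>i<r. a i * u i l))"
      then obtain a where a: "v = Matrix.vec d (\<lambda>l. \<Sum>i<r. a i * u i l)" by blast
      have "v = Matrix.vec d (\<lambda>l. \<Sum>i<r. (a i / \<nu> i) * us ! i $ l)"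
        unfolding a u_def by (auto intro!: eq_vecI sum.cong)
      then show "v \<in> range (\<lambda>c. Matrix.vec d (\<lambda>l. \<Sum>i<r. c i * us ! i $ l))"
        by (intro image_eqI[where x="\<lambda>i. a i / \<nu> i"]) auto
    qed
    finally show "V = range (\<lambda>a. Matrix.vec d (\<lambda>l. \<Sum>i<r. a i * u i l))" .
  qed
qed

subsection \<open>Johnson-Lindenstrauss and restricted isometry bounds\<close>

definition image_sq :: "nat \<Rightarrow> nat \<Rightarrow> (nat \<times> nat \<Rightarrow> real) \<Rightarrow> (nat \<Rightarrow> real) \<Rightarrow> real" where
  "image_sq d k \<omega> w = (\<Sum>j<k. (\<Sum>l<d. w l * \<omega> (l, j))\<^sup>2)"

lemma image_sq_nonneg: "0 \<le> image_sq d k \<omega> w"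
  by (simp add: image_sq_def sum_nonneg)

lemma l2norm_eq:
  assumes "v \<in> carrier_vec d"
  shows "l2norm v = sqrt (sq_norm d (($) v))"
  using assms by (simp add: l2norm_def sq_norm_def scalar_prod_def power2_eq_square lessThan_atLeast0)

lemma l2norm_image_eq:
  assumes "v \<in> carrier_vec d"
  shows "l2norm (transpose_mat (Matrix.mat d k \<omega>) *\<^sub>v v) = sqrt (image_sq d k \<omega> (($) v))"
proof -
  have "(transpose_mat (Matrix.mat d k \<omega>) *\<^sub>v v) $ j = (\<Sum>l<d. v $ l * \<omega> (l, j))" if "j < k" for j
    using assms that by (simp add: scalar_prod_def lessThan_atLeast0 mult.commute)
  moreover have "transpose_mat (Matrix.mat d k \<omega>) *\<^sub>v v \<in> carrier_vec k"
    by (intro mult_mat_vec_carrier[of _ _ d] assms) simp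
  ultimately show ?thesis unfolding image_sq_def by (subst l2norm_eq) (auto simp: sq_norm_def)
qed

lemma sq_norm_vec: "sq_norm d (($) (Matrix.vec d w)) = sq_norm d w"
  by (simp add: sq_norm_def)

lemma image_sq_vec: "image_sq d k \<omega> (($) (Matrix.vec d w)) = image_sq d k \<omega> w"
  by (simp add: image_sq_def)

lemma measurable_image_sq:
  assumes "sets D = sets borel"
  shows "(\<lambda>\<omega>. image_sq d k \<omega> w) \<in> borel_measurable (iid_entries d k D)"
  unfolding image_sq_def using measurable_entry[OF assms]
  by (intro borel_measurable_sum borel_measurable_power borel_measurable_times) auto

text \<open>Both sides are homogeneous of degree two in w, which reduces the claim to unit vectors.
  For w of norm zero the strict inequality makes the event empty.\<close>

lemma image_sq_deviation:
  fixes w :: "nat \<Rightarrow> real"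
  assumes D: "entry_distribution K k D" and K: "0 < K" and k: "0 < k" and \<epsilon>: "0 < \<epsilon>" "\<epsilon> < 1"
  shows "\<P>(\<omega> in iid_entries d k D. \<epsilon> * sq_norm d w < \<bar>image_sq d k \<omega> w - sq_norm d w\<bar>)
    \<le> 2 * exp (- (\<epsilon>\<^sup>2 * k / (4 * mgf_const K)))"
proof (cases "sq_norm d w = 0")
  case True
  then have "\<forall>l<d. w l = 0" by (simp add: sq_norm_def sum_nonneg_eq_0_iff)
  then have "image_sq d k \<omega> w = 0" for \<omega> by (simp add: image_sq_def)
  then show ?thesis using True by simp
next
  case False
  define t where "t = sqrt (sq_norm d w)"
  have t: "0 < t" "t\<^sup>2 = sq_norm d w" using False sq_norm_nonneg[of d w] by (simp_all add: t_def)
  define c where "c l = w l / t" for l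
  have c1: "(\<Sum>l<d. (c l)\<^sup>2) = 1"
    using t False by (simp add: c_def power_divide sum_divide_distrib[symmetric] sq_norm_def)
  have img: "image_sq d k \<omega> w = t\<^sup>2 * (\<Sum>j<k. (\<Sum>l<d. c l * \<omega> (l, j))\<^sup>2)" for \<omega>
  proof -
    have "(\<Sum>l<d. w l * \<omega> (l, j)) = t * (\<Sum>l<d. c l * \<omega> (l, j))" for j
      using t(1) by (simp add: sum_distrib_left c_def)
    then show ?thesis unfolding image_sq_def by (simp only: power_mult_distrib sum_distrib_left[symmetric])
  qed
  have "\<epsilon> * sq_norm d w < \<bar>image_sq d k \<omega> w - sq_norm d w\<bar>
      \<longleftrightarrow> \<epsilon> < \<bar>(\<Sum>j<k. (\<Sum>l<d. c l * \<omega> (l, j))\<^sup>2) - 1\<bar>" for \<omega>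
  proof -
    have "image_sq d k \<omega> w - sq_norm d w = t\<^sup>2 * ((\<Sum>j<k. (\<Sum>l<d. c l * \<omega> (l, j))\<^sup>2) - 1)"
      unfolding img t(2)[symmetric] by (simp add: right_diff_distrib)
    then have "\<bar>image_sq d k \<omega> w - sq_norm d w\<bar> = t\<^sup>2 * \<bar>(\<Sum>j<k. (\<Sum>l<d. c l * \<omega> (l, j))\<^sup>2) - 1\<bar>"
      by (simp add: abs_mult)
    then show ?thesis unfolding t(2)[symmetric] mult.commute[of \<epsilon>] using t(1) by simp
  qed
  then show ?thesis using iid_column_deviation[OF D K k c1 \<epsilon>] by simp
qed

lemma JL_transform_iid:
  assumes D: "entry_distribution K k D" and K: "0 < K" and k: "0 < k" and \<epsilon>: "0 < \<epsilon>" "\<epsilon> < 1"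
    and \<delta>: "real m * (2 * exp (- (\<epsilon>\<^sup>2 * k / (4 * mgf_const K)))) \<le> \<delta>"
  shows "JL_transform (iid_entries d k D) (Matrix.mat d k) d m \<epsilon> \<delta>"
  unfolding JL_transform_def
proof (intro allI impI)
  fix v :: "nat \<Rightarrow> real Matrix.vec"
  assume v: "\<forall>i\<in>{1..m}. v i \<in> carrier_vec d"
  define M where "M = iid_entries d k D"
  note D' = entry_distributionD[OF D]
  interpret prob_space M unfolding M_def by (rule prob_space_iid_entries[OF D'(1)])
  note [measurable] = measurable_image_sq[OF D'(2), of d k, folded M_def]
  define bad where "bad i = {\<omega> \<in> space M. \<epsilon> * sq_norm d (($) (v i)) < \<bar>image_sq d k \<omega> (($) (v i)) - sq_norm d (($) (v i))\<bar>}" for i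
  have bad [measurable]: "bad i \<in> events" for i unfolding bad_def by measurable
  define good where "good = {\<omega> \<in> space M. \<forall>i\<in>{1..m}.
    (1 - \<epsilon>) * (l2norm (v i))\<^sup>2 \<le> (l2norm (transpose_mat (Matrix.mat d k \<omega>) *\<^sub>v v i))\<^sup>2 \<and>
    (l2norm (transpose_mat (Matrix.mat d k \<omega>) *\<^sub>v v i))\<^sup>2 \<le> (1 + \<epsilon>) * (l2norm (v i))\<^sup>2}"
  have "good = space M - (\<Union>i\<in>{1..m}. bad i)"
  proof -
    have "(1 - \<epsilon>) * (l2norm (v i))\<^sup>2 \<le> (l2norm (transpose_mat (Matrix.mat d k \<omega>) *\<^sub>v v i))\<^sup>2 \<and>
      (l2norm (transpose_mat (Matrix.mat d k \<omega>) *\<^sub>v v i))\<^sup>2 \<le> (1 + \<epsilon>) * (l2norm (v i))\<^sup>2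
      \<longleftrightarrow> \<not> \<epsilon> * sq_norm d (($) (v i)) < \<bar>image_sq d k \<omega> (($) (v i)) - sq_norm d (($) (v i))\<bar>"
      if "i \<in> {1..m}" for i \<omega>
    proof -
      have "v i \<in> carrier_vec d" using v that by blast
      then show ?thesis
        by (simp add: l2norm_eq[of "v i" d] l2norm_image_eq sq_norm_nonneg image_sq_nonneg left_diff_distrib distrib_right) linarith
    qed
    then show ?thesis unfolding good_def bad_def by blast
  qed
  moreover have "prob (\<Union>i\<in>{1..m}. bad i) \<le> \<delta>"
  proof -
    have "prob (\<Union>i\<in>{1..m}. bad i) \<le> (\<Sum>i\<in>{1..m}. prob (bad i))"
      by (intro finite_measure_subadditive_finite) auto
    also have "\<dots> \<le> (\<Sum>i\<in>{1..m}. 2 * exp (- (\<epsilon>\<^sup>2 * k / (4 * mgf_const K))))"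
      unfolding bad_def M_def by (intro sum_mono image_sq_deviation[OF D K k \<epsilon>])
    also have "\<dots> \<le> \<delta>" using \<delta> by simp
    finally show ?thesis .
  qed
  ultimately show "1 - \<delta> \<le> \<P>(\<omega> in iid_entries d k D. \<forall>i\<in>{1..m}.
    (1 - \<epsilon>) * (l2norm (v i))\<^sup>2 \<le> (l2norm (transpose_mat (Matrix.mat d k \<omega>) *\<^sub>v v i))\<^sup>2 \<and>
    (l2norm (transpose_mat (Matrix.mat d k \<omega>) *\<^sub>v v i))\<^sup>2 \<le> (1 + \<epsilon>) * (l2norm (v i))\<^sup>2)"
    unfolding M_def[symmetric] good_def[symmetric]
    using prob_compl[of "\<Union>i\<in>{1..m}. bad i"] by simp
qed

text \<open>A closed set that contains a dense set is the whole space. A universal quantifier over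
  an uncountable space thereby becomes a countable intersection.\<close>

lemma countable_dense_closed:
  obtains S :: "'a::second_countable_topology set"
    where "countable S" "\<And>P. closed {a. P a} \<Longrightarrow> (\<forall>a\<in>S. P a) \<longleftrightarrow> (\<forall>a. P a)"
proof -
  obtain S :: "'a set" where S: "countable S" "\<And>X. open X \<Longrightarrow> X \<noteq> {} \<Longrightarrow> \<exists>d\<in>S. d \<in> X"
    using countable_dense_setE by metis
  show ?thesis
  proof (rule that[OF S(1)])
    fix P :: "'a \<Rightarrow> bool" assume "closed {a. P a}"
    then have "open {a. \<not> P a}" by (simp add: closed_def Collect_neg_eq)
    then show "(\<forall>a\<in>S. P a) \<longleftrightarrow> (\<forall>a. P a)" using S(2)[of "{a. \<not> P a}"] by auto
  qed
qed

lemma sq_norm_orthonormal: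
  assumes "\<And>i j. i < r \<Longrightarrow> j < r \<Longrightarrow> (\<Sum>l<d. u i l * u j l) = (if i = j then 1 else (0 :: real))"
  shows "sq_norm d (\<lambda>l. \<Sum>i<r. a i * u i l) = sq_norm r a"
proof -
  have "sq_norm d (\<lambda>l. \<Sum>i<r. a i * u i l) = (\<Sum>l<d. \<Sum>i<r. \<Sum>j<r. a i * a j * (u i l * u j l))"
    by (simp add: sq_norm_def power2_eq_square sum_product mult_ac)
  also have "\<dots> = (\<Sum>i<r. \<Sum>l<d. \<Sum>j<r. a i * a j * (u i l * u j l))" by (rule sum.swap)
  also have "\<dots> = (\<Sum>i<r. \<Sum>j<r. \<Sum>l<d. a i * a j * (u i l * u j l))"
    by (intro sum.cong refl sum.swap)
  also have "\<dots> = (\<Sum>i<r. \<Sum>j<r. a i * a j * (if i = j then 1 else 0))"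
    using assms by (simp flip: sum_distrib_left)
  also have "\<dots> = sq_norm r a" by (simp add: sq_norm_def power2_eq_square if_distrib cong: if_cong)
  finally show ?thesis .
qed

text \<open>The coefficients form the Gram matrix of the images of the vectors \<open>u i\<close>,
  minus the identity.\<close>

lemma image_sq_quad_form:
  "image_sq d k \<omega> (\<lambda>l. \<Sum>i<r. a i * u i l) - sq_norm r a
    = quad_form r (\<lambda>i j. (\<Sum>c<k. (\<Sum>l<d. u i l * \<omega> (l, c)) * (\<Sum>l<d. u j l * \<omega> (l, c))) - (if i = j then 1 else 0)) a"
proof -
  define y where "y i c = (\<Sum>l<d. u i l * \<omega> (l, c))" for i c
  have "(\<Sum>l<d. (\<Sum>i<r. a i * u i l) * \<omega> (l, c)) = (\<Sum>i<r. a i * y i c)" for c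
    unfolding y_def sum_distrib_left sum_distrib_right by (subst sum.swap) (simp add: mult.assoc)
  then have "image_sq d k \<omega> (\<lambda>l. \<Sum>i<r. a i * u i l) = (\<Sum>c<k. \<Sum>i<r. \<Sum>j<r. y i c * y j c * a i * a j)"
    by (simp add: image_sq_def power2_eq_square sum_product mult_ac)
  also have "\<dots> = (\<Sum>i<r. \<Sum>c<k. \<Sum>j<r. y i c * y j c * a i * a j)" by (rule sum.swap)
  also have "\<dots> = (\<Sum>i<r. \<Sum>j<r. \<Sum>c<k. y i c * y j c * a i * a j)"
    by (intro sum.cong refl sum.swap)
  finally have 1: "image_sq d k \<omega> (\<lambda>l. \<Sum>i<r. a i * u i l) = (\<Sum>i<r. \<Sum>j<r. (\<Sum>c<k. y i c * y j c) * a i * a j)"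
    by (simp add: sum_distrib_right)
  have 2: "sq_norm r a = (\<Sum>i<r. \<Sum>j<r. (if i = j then 1 else 0) * a i * a j)"
    by (simp add: sq_norm_def power2_eq_square if_distrib[of "\<lambda>x. x * _"] cong: if_cong)
  show ?thesis unfolding 1 2 quad_form_def y_def by (simp only: sum_subtractf[symmetric] left_diff_distrib)
qed

text \<open>Since (1 - \<epsilon>)^2 \<le> 1 - \<epsilon> and 1 + \<epsilon> \<le> (1 +
  \<epsilon>)^2, taking roots costs nothing: the same \<epsilon> serves for squared norms and for
  norms.\<close>

lemma sqrt_bounds_of_sq_deviation:
  fixes x y \<epsilon> :: real
  assumes "\<bar>y - x\<bar> \<le> \<epsilon> * x" "0 \<le> x" "0 < \<epsilon>" "\<epsilon> < 1"
  shows "(1 - \<epsilon>) * sqrt x \<le> sqrt y" "sqrt y \<le> (1 + \<epsilon>) * sqrt x"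
proof -
  have "(1 - \<epsilon>)\<^sup>2 \<le> 1 - \<epsilon>" "1 + \<epsilon> \<le> (1 + \<epsilon>)\<^sup>2" using assms by (simp_all add: power2_eq_square)
  then have "(1 - \<epsilon>)\<^sup>2 * x \<le> (1 - \<epsilon>) * x" "(1 + \<epsilon>) * x \<le> (1 + \<epsilon>)\<^sup>2 * x"
    using assms(2) by (auto intro: mult_right_mono)
  moreover have "(1 - \<epsilon>) * x \<le> y" "y \<le> (1 + \<epsilon>) * x" using assms(1) by (auto simp: abs_le_iff algebra_simps)
  ultimately have "sqrt ((1 - \<epsilon>)\<^sup>2 * x) \<le> sqrt y" "sqrt y \<le> sqrt ((1 + \<epsilon>)\<^sup>2 * x)" by auto
  then show "(1 - \<epsilon>) * sqrt x \<le> sqrt y" "sqrt y \<le> (1 + \<epsilon>) * sqrt x"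
    using assms by (simp_all add: real_sqrt_mult)
qed

lemma restricted_isometry_iid:
  assumes D: "entry_distribution K k D" and K: "0 < K" and k: "0 < k" and \<epsilon>: "0 < \<epsilon>" "\<epsilon> < 1" and r: "0 < r"
    and \<delta>: "2 ^ (66 * r) * (2 * exp (- ((\<epsilon> / 2)\<^sup>2 * k / (4 * mgf_const K)))) \<le> \<delta>"
  shows "restricted_isometry (iid_entries d k D) (Matrix.mat d k) d r \<epsilon> \<delta>"
  unfolding restricted_isometry_def
proof (intro allI impI)
  fix V assume sub: "linear_subspace d r V"
  obtain u where
    orth: "\<forall>i<r. \<forall>j<r. (\<Sum>l<d. u i l * u j l) = (if i = j then 1 else (0 :: real))"
    and V: "V = range (\<lambda>a. Matrix.vec d (\<lambda>l. \<Sum>i<r. a i * u i l))"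
    by (rule subspace_orthonormal_basis[OF sub])
  define M where "M = iid_entries d k D"
  note D' = entry_distributionD[OF D]
  interpret prob_space M unfolding M_def by (rule prob_space_iid_entries[OF D'(1)])
  note [measurable] = measurable_image_sq[OF D'(2), of d k, folded M_def]
  define w where "w a l = (\<Sum>i<r. a i * u i l)" for a l
  have w_eq: "(\<lambda>l. \<Sum>i<r. a i * u i l) = w a" for a by (simp add: w_def fun_eq_iff)
  have w: "sq_norm d (w a) = sq_norm r a" for a
    unfolding w_eq[symmetric] using orth by (intro sq_norm_orthonormal) auto
  define G where "G \<omega> a \<longleftrightarrow> (1 - \<epsilon>) * sqrt (sq_norm r a) \<le> sqrt (image_sq d k \<omega> (w a)) \<and>
    sqrt (image_sq d k \<omega> (w a)) \<le> (1 + \<epsilon>) * sqrt (sq_norm r a)" for \<omega> a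
  define good where "good = {\<omega> \<in> space M. \<forall>v\<in>V.
    (1 - \<epsilon>) * l2norm v \<le> l2norm (transpose_mat (Matrix.mat d k \<omega>) *\<^sub>v v) \<and>
    l2norm (transpose_mat (Matrix.mat d k \<omega>) *\<^sub>v v) \<le> (1 + \<epsilon>) * l2norm v}"
  have good: "good = {\<omega> \<in> space M. \<forall>a. G \<omega> a}"
    unfolding good_def V w_eq G_def
    by (simp add: l2norm_eq[of "Matrix.vec d _" d] l2norm_image_eq sq_norm_vec image_sq_vec w)
  \<comment> \<open>A non-measurable set has measure zero by convention, so the lower bound by
    monotonicity depends on this. For fixed \<omega>, all quantities in \<open>G\<close> are
    continuous in a for the product topology.\<close>
  have good_sets: "good \<in> events"
  proof -
    obtain S :: "(nat \<Rightarrow> real) set" where S: "countable S"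
      "\<And>P. closed {a. P a} \<Longrightarrow> (\<forall>a\<in>S. P a) \<longleftrightarrow> (\<forall>a. P a)" using countable_dense_closed by metis
    have "closed {a. G \<omega> a}" for \<omega>
      unfolding G_def sq_norm_def image_sq_def w_def
      by (intro closed_Collect_conj closed_Collect_le continuous_intros continuous_on_product_coordinates)
    then have "good = {\<omega> \<in> space M. \<forall>a\<in>S. G \<omega> a}" unfolding good using S(2) by simp
    also have "\<dots> \<in> events" unfolding G_def using S(1) by measurable
    finally show ?thesis .
  qed
  obtain N where N: "finite N" "real (card N) \<le> 2 ^ (66 * r)"
    "\<And>a. sq_norm r a \<le> 1 \<Longrightarrow> \<exists>b\<in>N. sq_norm r b \<le> 1 \<and> sq_norm r (\<lambda>i. a i - b i) \<le> 1 / 64"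
    using unit_ball_net[OF r] by metis
  \<comment> \<open>The threshold is \<epsilon> / 2 because the passage from the net to all vectors
    doubles it.\<close>
  define bad where "bad b = {\<omega> \<in> space M. \<epsilon> / 2 * sq_norm d (w b) < \<bar>image_sq d k \<omega> (w b) - sq_norm d (w b)\<bar>}" for b
  have bad [measurable]: "bad b \<in> events" for b unfolding bad_def by measurable
  have "prob (\<Union>b\<in>N. bad b) \<le> (\<Sum>b\<in>N. prob (bad b))"
    using N(1) by (intro finite_measure_subadditive_finite) auto
  also have "\<dots> \<le> (\<Sum>b\<in>N. 2 * exp (- ((\<epsilon> / 2)\<^sup>2 * k / (4 * mgf_const K))))"
    unfolding bad_def M_def using \<epsilon> by (intro sum_mono image_sq_deviation[OF D K k]) auto
  also have "\<dots> \<le> 2 ^ (66 * r) * (2 * exp (- ((\<epsilon> / 2)\<^sup>2 * k / (4 * mgf_const K))))"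
    using N(2) by (simp add: mult_right_mono)
  finally have "prob (\<Union>b\<in>N. bad b) \<le> \<delta>" using \<delta> by linarith
  then have "1 - \<delta> \<le> prob (space M - (\<Union>b\<in>N. bad b))"
    using prob_compl[OF sets.finite_UN[OF N(1) bad]] by simp
  also have "\<dots> \<le> prob good"
  proof (rule finite_measure_mono[OF _ good_sets], rule subsetI)
    fix \<omega> assume \<omega>: "\<omega> \<in> space M - (\<Union>b\<in>N. bad b)"
    define A where "A = (\<lambda>i j. (\<Sum>c<k. (\<Sum>l<d. u i l * \<omega> (l, c)) * (\<Sum>l<d. u j l * \<omega> (l, c))) - (if i = j then 1 else 0))"
    have A: "quad_form r A a = image_sq d k \<omega> (w a) - sq_norm r a" for a
      unfolding A_def w_eq[symmetric] by (rule image_sq_quad_form[symmetric])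
    have "G \<omega> a" for a
    proof -
      have "\<exists>b. \<bar>quad_form r A b\<bar> \<le> \<epsilon> / 2 \<and> sq_norm r b \<le> 1 \<and> sq_norm r (\<lambda>i. a i - b i) \<le> 1 / 64"
        if "sq_norm r a = 1" for a
      proof -
        have "sq_norm r a \<le> 1" using that by simp
        then obtain b where b: "b \<in> N" "sq_norm r b \<le> 1" "sq_norm r (\<lambda>i. a i - b i) \<le> 1 / 64"
          using N(3) by blast
        have "\<bar>quad_form r A b\<bar> \<le> \<epsilon> / 2 * sq_norm r b"
          using \<omega> b(1) by (auto simp: bad_def A w)
        also have "\<dots> \<le> \<epsilon> / 2 * 1" using b(2) \<epsilon> by (intro mult_left_mono) auto
        finally show ?thesis using b by auto
      qed
      then have "\<bar>quad_form r A a\<bar> \<le> 2 * (\<epsilon> / 2) * sq_norm r a"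
        using \<epsilon> by (intro quad_form_bound_net) auto
      then have "\<bar>image_sq d k \<omega> (w a) - sq_norm r a\<bar> \<le> \<epsilon> * sq_norm r a" by (simp add: A)
      from sqrt_bounds_of_sq_deviation[OF this sq_norm_nonneg \<epsilon>] show ?thesis by (simp add: G_def)
    qed
    then show "\<omega> \<in> good" using \<omega> good by auto
  qed
  finally show "1 - \<delta> \<le> \<P>(\<omega> in iid_entries d k D. \<forall>v\<in>V.
    (1 - \<epsilon>) * l2norm v \<le> l2norm (transpose_mat (Matrix.mat d k \<omega>) *\<^sub>v v) \<and>
    l2norm (transpose_mat (Matrix.mat d k \<omega>) *\<^sub>v v) \<le> (1 + \<epsilon>) * l2norm v)"
    unfolding good_def M_def .
qed

section \<open>From the sample bound to the failure probabilities\<close>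

lemma ln_2_ge_half: "1 / 2 \<le> ln (2 :: real)"
proof -
  have "(exp (1 / 2 :: real))\<^sup>2 \<le> 2\<^sup>2"
    using exp_le by (simp add: exp_double[symmetric])
  then have "exp (1 / 2 :: real) \<le> 2" by (rule power2_le_imp_le) simp
  then show ?thesis using ln_le_cancel_iff[of "exp (1 / 2)" "2 :: real"] by simp
qed

text \<open>In \<open>4288 = 64 * 67\<close> the factor \<open>67\<close> beats the net cardinality \<open>2 ^ (66 r)\<close>, and \<open>64\<close> pays
  for halving \<open>\<epsilon>\<close> and for the lower bound \<open>C s (1 + ln (1 / \<epsilon>)) / 16\<close> on \<open>\<epsilon>\<^sup>2 k\<close>.\<close>

definition sample_const :: "real \<Rightarrow> real" where
  "sample_const K = 4288 * (4 * mgf_const K)"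

text \<open>The factor r in the sample bound pays for dividing \<epsilon> by sqrt r. The union bound
  costs 4 n r \<le> (n r)^3, as n r \<ge> 2, so out of an exponent 4 ln (n r) one ln (n r)
  remains.\<close>

lemma JL_failure_bound:
  assumes K: "0 < K" and n: "2 \<le> n" and r: "0 < r" and \<epsilon>: "0 < \<epsilon>"
    and k: "sample_const K * (1 / \<epsilon>\<^sup>2 * real r * (ln (real r) + ln (real n))) \<le> real k"
  shows "real (2 * n * r) * (2 * exp (- ((\<epsilon> / sqrt r)\<^sup>2 * k / (4 * mgf_const K)))) \<le> exp (- ln (real (n * r)))"
proof -
  define L where "L = ln (real (n * r))"
  have L: "L = ln (real r) + ln (real n)" using n r by (simp add: L_def ln_mult)
  have eL: "exp L = real (n * r)" using n r by (simp add: L_def)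
  have "2 \<le> n * r" using n r by (metis One_nat_def Suc_leI mult.right_neutral mult_le_mono)
  then have "2 \<le> real (n * r)" by linarith
  then have "2 * 2 \<le> real (n * r) * real (n * r)" by (intro mult_mono) auto
  then have 4: "4 \<le> exp (2 * L)" unfolding mult_2 exp_add eL by simp
  have L0: "0 \<le> L" using \<open>2 \<le> real (n * r)\<close> by (simp add: L_def)
  have C: "0 < mgf_const K" using K by (rule mgf_const_pos)
  have "(\<epsilon> / sqrt r)\<^sup>2 * (sample_const K * (1 / \<epsilon>\<^sup>2 * real r * L)) / (4 * mgf_const K)
      \<le> (\<epsilon> / sqrt r)\<^sup>2 * k / (4 * mgf_const K)"
    using k C unfolding L by (intro divide_right_mono mult_left_mono) auto
  also have "(\<epsilon> / sqrt r)\<^sup>2 * (sample_const K * (1 / \<epsilon>\<^sup>2 * real r * L)) / (4 * mgf_const K) = 4288 * L"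
    using C \<epsilon> r by (simp add: sample_const_def power_divide)
  finally have X: "4 * L \<le> (\<epsilon> / sqrt r)\<^sup>2 * k / (4 * mgf_const K)" using L0 by linarith
  have "real (2 * n * r) * (2 * exp (- ((\<epsilon> / sqrt r)\<^sup>2 * k / (4 * mgf_const K)))) \<le> real (2 * n * r) * (2 * exp (- (4 * L)))"
    using X by (intro mult_left_mono) auto
  also have "\<dots> = 4 * (exp L * exp (- (4 * L)))" unfolding eL by simp
  also have "\<dots> \<le> exp (2 * L) * (exp L * exp (- (4 * L)))" using 4 by (intro mult_right_mono) auto
  also have "\<dots> = exp (- L)" by (simp add: exp_add[symmetric])
  finally show ?thesis by (simp add: L_def)
qed

text \<open>Besides ln (1 / \<epsilon>) s the exponent needs a multiple of s itself against the net,
  hence the term 1 + l. For \<epsilon> \<le> 1 / 2 the logarithm l is at least 1 / 2 and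
  \<open>k1\<close> suffices; otherwise l < 1 and \<epsilon>^2 \<ge> 1 / 4, so \<open>k2\<close>
  does.\<close>

lemma RIP_failure_bound:
  fixes s :: real
  assumes K: "0 < K" and \<epsilon>: "0 < \<epsilon>" "\<epsilon> < 1" and s: "1 \<le> s" "real r \<le> s"
    and k1: "sample_const K * (1 / \<epsilon>\<^sup>2 * ln (1 / \<epsilon>) * s) \<le> real k"
    and k2: "sample_const K * (ln 2 * s) \<le> real k"
  shows "2 ^ (66 * r) * (2 * exp (- ((\<epsilon> / 2)\<^sup>2 * k / (4 * mgf_const K)))) \<le> exp (- (ln (1 / \<epsilon>) * s))"
proof -
  define l where "l = ln (1 / \<epsilon>)"
  define C where "C = sample_const K"
  have m: "0 < mgf_const K" using K by (rule mgf_const_pos)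
  have C: "0 < C" using m by (simp add: C_def sample_const_def)
  have l: "0 < l" using \<epsilon> by (simp add: l_def)
  have "C * (s * (1 + l)) / 16 \<le> \<epsilon>\<^sup>2 * k"
  proof (cases "\<epsilon> \<le> 1 / 2")
    case True
    have "ln 2 \<le> l" unfolding l_def using True \<epsilon> by (subst ln_le_cancel_iff) (auto simp: field_simps)
    then have "1 + l \<le> 3 * l" using ln_2_ge_half by linarith
    have "C * (s * (1 + l)) / 16 \<le> C * (s * (3 * l)) / 16"
      using C s \<open>1 + l \<le> 3 * l\<close> by (intro divide_right_mono mult_left_mono) auto
    also have "\<dots> \<le> C * (s * l)" using C s l by simp
    also have "\<dots> = \<epsilon>\<^sup>2 * (C * (1 / \<epsilon>\<^sup>2 * l * s))" using \<epsilon> by simp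
    also have "\<dots> \<le> \<epsilon>\<^sup>2 * k" using k1 unfolding C_def l_def by (intro mult_left_mono) auto
    finally show ?thesis .
  next
    case False
    have "l \<le> ln 2" unfolding l_def using False \<epsilon> by (subst ln_le_cancel_iff) (auto simp: field_simps)
    then have "1 + l \<le> 2" using ln_2_less_1 by linarith
    have "(1 / 2)\<^sup>2 \<le> \<epsilon>\<^sup>2" using False by (intro power_mono) auto
    then have e: "1 / 4 \<le> \<epsilon>\<^sup>2" by (simp add: power2_eq_square)
    have "C * (s * (1 + l)) / 16 \<le> C * (s * 2) / 16"
      using C s \<open>1 + l \<le> 2\<close> by (intro divide_right_mono mult_left_mono) auto
    also have "\<dots> = 1 / 4 * (C * (1 / 2 * s))" by simp
    also have "\<dots> \<le> 1 / 4 * (C * (ln 2 * s))"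
      using C s ln_2_ge_half by (intro mult_left_mono mult_right_mono) auto
    also have "\<dots> \<le> \<epsilon>\<^sup>2 * k" using k2 e C s unfolding C_def by (intro mult_mono) auto
    finally show ?thesis .
  qed
  then have "C * (s * (1 + l)) / 16 / (16 * mgf_const K) \<le> \<epsilon>\<^sup>2 * k / (16 * mgf_const K)"
    using m by (intro divide_right_mono) auto
  also have "C * (s * (1 + l)) / 16 / (16 * mgf_const K) = 67 * (s * (1 + l))"
    using m by (simp add: C_def sample_const_def)
  also have "\<epsilon>\<^sup>2 * k / (16 * mgf_const K) = (\<epsilon> / 2)\<^sup>2 * k / (4 * mgf_const K)"
    by (simp add: power_divide)
  finally have X: "67 * (s * (1 + l)) \<le> (\<epsilon> / 2)\<^sup>2 * k / (4 * mgf_const K)" .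
  have two: "2 \<le> exp (1 :: real)" using exp_ge_add_one_self[of "1 :: real"] by simp
  have "(2 :: real) ^ (66 * r) \<le> exp 1 ^ (66 * r)" using two by (intro power_mono) auto
  also have "\<dots> = exp (66 * real r)" using exp_of_nat_mult[of "66 * r" "1 :: real"] by simp
  finally have "2 ^ (66 * r) * (2 * exp (- ((\<epsilon> / 2)\<^sup>2 * k / (4 * mgf_const K))))
      \<le> exp (66 * real r) * (exp 1 * exp (- (67 * (s * (1 + l)))))"
    using X two by (intro mult_mono) auto
  also have "\<dots> = exp (66 * real r + 1 - 67 * (s * (1 + l)))" by (simp add: exp_add[symmetric] algebra_simps)
  \<comment> \<open>Here r \<le> s and 1 \<le> s give 66 r + 1 \<le> 67 s: the extra s pays for the
    factor 2 of the two-sided tail.\<close>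
  also have "\<dots> \<le> exp (- (l * s))"
  proof -
    have "0 \<le> l * s" using l s by simp
    moreover have "s * (1 + l) = s + l * s" by (simp add: algebra_simps)
    ultimately show ?thesis using s by simp
  qed
  finally show ?thesis by (simp add: l_def)
qed

text \<open>Covers n = 1: then r = 1 and the allowed failure probability exp (- ln 1) is
  one.\<close>

lemma JL_transform_trivial: "1 \<le> \<delta> \<Longrightarrow> JL_transform M R d m \<epsilon> \<delta>"
  unfolding JL_transform_def by (auto intro: order_trans[OF _ measure_nonneg])

text \<open>The parameter s treats both forms of the second term at once, s = r and s = max r (ln
  n).\<close>

lemma sample_bound_sufficient:
  fixes s :: real
  assumes K: "0 < K" and n: "0 < n" and k: "0 < k" and r: "r \<in> {1..min d n}"
    and \<epsilon>1: "\<epsilon>1 \<in> {0<..<1}" and \<epsilon>2: "\<epsilon>2 \<in> {0<..<1}" and D: "entry_distribution K k D"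
    and s: "real r \<le> s" "s \<le> max (real r) (ln (real n))"
    and sb: "sample_bound (sample_const K) k n r \<epsilon>1 \<epsilon>2 s" and n1: "n = 1 \<longrightarrow> sample_const K \<le> real k"
  shows "JL_transform (iid_entries d k D) (Matrix.mat d k) d (2 * n * r)
            (\<epsilon>1 / sqrt (real r)) (exp (- 1 * ln (real (n * r))))"
    and "restricted_isometry (iid_entries d k D) (Matrix.mat d k) d r
            \<epsilon>2 (exp (- 1 * ln (1 / \<epsilon>2) * s))"
proof -
  define C where "C = sample_const K"
  have C: "0 < C" using mgf_const_pos[OF K] by (simp add: C_def sample_const_def)
  have r1: "1 \<le> r" "r \<le> n" using r by auto
  define T1 where "T1 = 1 / \<epsilon>1\<^sup>2 * real r * (ln (real r) + ln (real n))"
  define T2 where "T2 = 1 / \<epsilon>2\<^sup>2 * ln (1 / \<epsilon>2) * s"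
  have kC: "C * max T1 T2 \<le> real k"
    using sb by (simp add: sample_bound_def C_def T1_def T2_def)
  have "C * T1 \<le> C * max T1 T2" "C * T2 \<le> C * max T1 T2" using C by (auto intro!: mult_left_mono)
  then have k1: "C * T1 \<le> real k" and k2: "C * T2 \<le> real k" using kC by linarith+
  have "1 \<le> sqrt (real r)" using r1 by simp
  with \<epsilon>1 have "\<epsilon>1 < sqrt (real r)" by (meson greaterThanLessThan_iff less_le_trans)
  then have e: "0 < \<epsilon>1 / sqrt (real r)" "\<epsilon>1 / sqrt (real r) < 1"
    using \<epsilon>1 r1 by (auto simp: divide_less_eq)
  show "JL_transform (iid_entries d k D) (Matrix.mat d k) d (2 * n * r)
            (\<epsilon>1 / sqrt (real r)) (exp (- 1 * ln (real (n * r))))"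
  proof (cases "n = 1")
    case True
    then show ?thesis using r1 by (intro JL_transform_trivial) simp
  next
    case False
    have "real (2 * n * r) * (2 * exp (- ((\<epsilon>1 / sqrt r)\<^sup>2 * k / (4 * mgf_const K)))) \<le> exp (- ln (real (n * r)))"
      using False n r1 \<epsilon>1 k1 unfolding C_def T1_def by (intro JL_failure_bound[OF K]) auto
    then show ?thesis by (intro JL_transform_iid[OF D K k e]) simp
  qed
  \<comment> \<open>For n \<ge> 2 the first term of the sample bound dominates ln 2 s, through ln 2
    \<le> ln n if s \<le> r and through ln 2 < 1 \<le> r if s \<le> ln n. For n = 1 that term is
    zero, s = 1, and \<open>n1\<close> takes its place.\<close>
  have k3: "C * (ln 2 * s) \<le> real k"
  proof (cases "n = 1")
    case True
    then have "s = 1" using s r1 by auto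
    then have "C * (ln 2 * s) \<le> C * 1" using C ln_2_less_1 by (intro mult_left_mono) auto
    then show ?thesis using n1 True by (simp add: C_def)
  next
    case False
    have n2: "ln 2 \<le> ln (real n)" using False n by simp
    have lnr: "0 \<le> ln (real r)" "0 \<le> ln (real n)" using r1 n by simp_all
    have "ln 2 * s \<le> real r * ln (real n)"
    proof (cases "s \<le> real r")
      case True
      then have "ln 2 * s \<le> ln (real n) * real r" using n2 s lnr by (intro mult_mono) auto
      then show ?thesis by (simp add: mult.commute)
    next
      case False
      then have "s \<le> ln (real n)" using s by auto
      then have "ln 2 * s \<le> 1 * ln (real n)" using ln_2_less_1 s r1 by (intro mult_mono) auto
      also have "\<dots> \<le> real r * ln (real n)" using r1 lnr by (intro mult_right_mono) auto
      finally show ?thesis .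
    qed
    also have "\<dots> \<le> 1 * (real r * (ln (real r) + ln (real n)))"
      using lnr by (simp add: mult_left_mono)
    also have "\<dots> \<le> 1 / \<epsilon>1\<^sup>2 * (real r * (ln (real r) + ln (real n)))"
      using \<epsilon>1 lnr n by (intro mult_right_mono) (auto simp: power_le_one)
    finally have "ln 2 * s \<le> T1" by (simp add: T1_def)
    then have "C * (ln 2 * s) \<le> C * T1" using C by simp
    then show ?thesis using k1 by linarith
  qed
  have "2 ^ (66 * r) * (2 * exp (- ((\<epsilon>2 / 2)\<^sup>2 * k / (4 * mgf_const K)))) \<le> exp (- (ln (1 / \<epsilon>2) * s))"
    using \<epsilon>2 s r1 k2 k3 unfolding C_def T2_def by (intro RIP_failure_bound[OF K]) auto
  then show "restricted_isometry (iid_entries d k D) (Matrix.mat d k) d r \<epsilon>2 (exp (- 1 * ln (1 / \<epsilon>2) * s))"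
    using \<epsilon>2 r1 by (intro restricted_isometry_iid[OF D K k]) auto
qed

text \<open>For positive n the probability is at most n to the power - ln (1 / \<epsilon>),
  uniformly in the sequence of ranks.\<close>

lemma failure_probability_tendsto:
  fixes r :: "nat \<Rightarrow> nat"
  assumes "\<epsilon> \<in> {0<..<1}"
  shows "(\<lambda>n. exp (- 1 * ln (1 / \<epsilon>) * max (real (r n)) (ln (real n)))) \<longlonglongrightarrow> 0"
proof (rule tendsto_sandwich[where f="\<lambda>_. 0" and h="\<lambda>n. exp (- (ln (1 / \<epsilon>) * ln (real n)))"])
  have l: "0 < ln (1 / \<epsilon>)" using assms by simp
  show "(\<lambda>n. exp (- (ln (1 / \<epsilon>) * ln (real n)))) \<longlonglongrightarrow> 0"
    using l by real_asymp
  show "\<forall>\<^sub>F n in sequentially. exp (- 1 * ln (1 / \<epsilon>) * max (real (r n)) (ln (real n))) \<le> exp (- (ln (1 / \<epsilon>) * ln (real n)))"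
    using l by (intro always_eventually allI) (auto intro!: mult_left_mono)
qed auto

theorem proposition1:
  shows "\<exists>c > (0::real). \<exists>c' > (0::real).
    (\<forall>K > (0::real). \<exists>C > (0::real).
      \<forall>(n::nat) (d::nat) (k::nat) (r::nat) (\<epsilon>1::real) (\<epsilon>2::real) (D::real measure).
        0 < n \<and> 0 < d \<and> 0 < k \<and> r \<in> {1..min d n} \<and> \<epsilon>1 \<in> {0<..<1} \<and> \<epsilon>2 \<in> {0<..<1} \<and>
        entry_distribution K k D \<and>
        sample_bound C k n r \<epsilon>1 \<epsilon>2 (real r) \<and> (n = 1 \<longrightarrow> C \<le> real k) \<longrightarrow>
          JL_transform (iid_entries d k D) (Matrix.mat d k) d (2 * n * r)
            (\<epsilon>1 / sqrt (real r)) (exp (- c' * ln (real (n * r)))) \<and>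
          restricted_isometry (iid_entries d k D) (Matrix.mat d k) d r
            \<epsilon>2 (exp (- c * ln (1 / \<epsilon>2) * real r))) \<and>
    (\<forall>K > (0::real). \<forall>B::nat. \<exists>C > (0::real).
      \<forall>(n::nat) (d::nat) (k::nat) (r::nat) (\<epsilon>1::real) (\<epsilon>2::real) (D::real measure).
        0 < n \<and> 0 < d \<and> 0 < k \<and> r \<in> {1..min d n} \<and> r \<le> B \<and> \<epsilon>1 \<in> {0<..<1} \<and> \<epsilon>2 \<in> {0<..<1} \<and>
        entry_distribution K k D \<and>
        sample_bound C k n r \<epsilon>1 \<epsilon>2 (max (real r) (ln (real n))) \<and> (n = 1 \<longrightarrow> C \<le> real k) \<longrightarrow>
          JL_transform (iid_entries d k D) (Matrix.mat d k) d (2 * n * r)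
            (\<epsilon>1 / sqrt (real r)) (exp (- c' * ln (real (n * r)))) \<and>
          restricted_isometry (iid_entries d k D) (Matrix.mat d k) d r
            \<epsilon>2 (exp (- c * ln (1 / \<epsilon>2) * max (real r) (ln (real n))))) \<and>
    (\<forall>(r :: nat \<Rightarrow> nat) \<epsilon>2. \<epsilon>2 \<in> {0<..<1} \<longrightarrow>
      (\<lambda>n. exp (- c * ln (1 / \<epsilon>2) * max (real (r n)) (ln (real n)))) \<longlonglongrightarrow> 0)"
proof -
  have C: "0 < sample_const K" if "0 < K" for K
    using mgf_const_pos[OF that] by (simp add: sample_const_def)
  show ?thesis
  \<comment> \<open>The witness one serves for c and c'. Cases 3 and 4 are the same lemma, with s =
    r and s = max r (ln n), and \<open>sample_const K\<close> as the constant.\<close>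
  proof (intro exI[of _ "1 :: real"] conjI, goal_cases)
    case 3
    show ?case
    proof (intro allI impI, rule exI, intro conjI allI impI, rule C, assumption)
    qed (elim conjE; rule sample_bound_sufficient; simp)+
  next
    case 4
    show ?case
    proof (intro allI impI, rule exI, intro conjI allI impI, rule C, assumption)
    qed (elim conjE; rule sample_bound_sufficient; simp)+
  next
    case 5
    show ?case by (intro allI impI failure_probability_tendsto)
  qed simp_all
qed

end
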